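(* Suppose $t>1/\rho_W$. Let $H\colon C_*(\Sigma)\to C_{*+1}(\Sigma)$ be a linear map satisfying (a)–(d) below. Then $H$ extends to a bounded operator $H\colon L^2_tC_*(\Sigma)\to L^2_tC_{*+1}(\Sigma)$. (a) $\partial H(v)=v-b$ for each vertex $v$, where $b$ is the cone vertex of the base chamber $D$; (b) $\partial H(\sigma)=\sigma-H(\partial\sigma)$ for each simplex $\sigma$ of positive dimension; (c) there is a constant $C$ with $\|H(\sigma)\|_{L^\infty}<C$ for all simplices $\sigma$; (d) there is a constant $R$ such that, for every $\sigma$ and every $d_M$-geodesic $\gamma$ from a vertex of $\sigma$ to $b$, the support of $H(\sigma)$ lies in the $R$-neighbourhood of $\gamma$.
   Context: $(W,S)$ is a Coxeter system with word length $d$. $W(x)=\sum_{w\in W}x^{d(w)}$ has radius of convergence $\rho_W$. $\Sigma$ is the Davis complex (standard triangulation) with base chamber $D$. For a simplex $\sigma$, $d(\sigma)=\min\{d(w):\sigma\subseteq wD\}$. $C_*(\Sigma)$ denotes finitely supported chains with the usual boundary $\partial$. $L^2_tC_k(\Sigma)$ is the Hilbert space of $k$-chains $\sum a_\sigma\sigma$ with $\sum|a_\sigma|^2t^{d(\sigma)}<\infty$. $d_M$ is the Moussong metric: a $W$-invariant CAT(0) piecewise Euclidean metric on $\Sigma$ such that every ball of radius $r$ meets at most $N(r)$ chambers. *)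

theory Defs
  imports "HOL-Analysis.Analysis" "HOL-Algebra.Multiplicative_Group" "HOL-Algebra.Generated_Groups"
begin

section \<open>Coxeter systems\<close>

text \<open>Product of a word (list of group elements) in the group.\<close>
definition word_prod :: "'w monoid \<Rightarrow> 'w list \<Rightarrow> 'w" where
  "word_prod G ws = foldr (\<lambda>x y. x \<otimes>\<^bsub>G\<^esub> y) ws \<one>\<^bsub>G\<^esub>"

text \<open>Coxeter relators (s t)^m(s,t), where m(s,t) is the order of s t
  (relators with m(s,t) = infinity, i.e. order 0, are absent).  For s = t this is s s.\<close>
definition coxeter_relators :: "'w monoid \<Rightarrow> 'w set \<Rightarrow> 'w list set" where
  "coxeter_relators G S =
     {concat (replicate (group.ord G (s \<otimes>\<^bsub>G\<^esub> t)) [s, t]) | s t.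
        s \<in> S \<and> t \<in> S \<and> group.ord G (s \<otimes>\<^bsub>G\<^esub> t) \<noteq> 0}"

text \<open>One elementary deletion of a relator from a word.\<close>
definition relator_step :: "'w monoid \<Rightarrow> 'w set \<Rightarrow> ('w list \<times> 'w list) set" where
  "relator_step G S = {(u @ r @ v, u @ v) | u r v. r \<in> coxeter_relators G S}"

text \<open>(W,S) is a Coxeter system: S is a finite generating set of involutions and
  W has the presentation  < S | (s t)^m(s,t) >, i.e. every word in S representing 1
  is reduced to the empty word by inserting/deleting relators.\<close>
definition coxeter_system :: "'w monoid \<Rightarrow> 'w set \<Rightarrow> bool" where
  "coxeter_system G S \<longleftrightarrow>
     group G \<and> finite S \<and> S \<subseteq> carrier G \<and>
     (\<forall>s\<in>S. s \<noteq> \<one>\<^bsub>G\<^esub> \<and> s \<otimes>\<^bsub>G\<^esub> s = \<one>\<^bsub>G\<^esub>) \<and>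
     generate G S = carrier G \<and>
     (\<forall>ws. set ws \<subseteq> S \<longrightarrow> word_prod G ws = \<one>\<^bsub>G\<^esub> \<longrightarrow>
        (ws, []) \<in> (relator_step G S \<union> (relator_step G S)\<inverse>)\<^sup>*)"

text \<open>Word length d(w) with respect to S.\<close>
definition word_length :: "'w monoid \<Rightarrow> 'w set \<Rightarrow> 'w \<Rightarrow> nat" where
  "word_length G S w = (LEAST n. \<exists>ws. set ws \<subseteq> S \<and> length ws = n \<and> word_prod G ws = w)"

text \<open>Coefficients of the growth series W(x) = sum_w x^d(w).\<close>
definition growth_coeff :: "'w monoid \<Rightarrow> 'w set \<Rightarrow> nat \<Rightarrow> real" where
  "growth_coeff G S n = real (card {w \<in> carrier G. word_length G S w = n})"

text \<open>rho_W, the radius of convergence of W(x).\<close>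
definition growth_radius :: "'w monoid \<Rightarrow> 'w set \<Rightarrow> ereal" where
  "growth_radius G S = conv_radius (growth_coeff G S)"

section \<open>The Davis complex (standard triangulation)\<close>

text \<open>Spherical subsets T of S: W_T finite.\<close>
definition spherical :: "'w monoid \<Rightarrow> 'w set \<Rightarrow> 'w set \<Rightarrow> bool" where
  "spherical G S T \<longleftrightarrow> T \<subseteq> S \<and> finite (generate G T)"

text \<open>Vertices of Sigma: the spherical cosets w W_T.\<close>
definition davis_vertices :: "'w monoid \<Rightarrow> 'w set \<Rightarrow> 'w set set" where
  "davis_vertices G S =
     {w <#\<^bsub>G\<^esub> generate G T | w T. w \<in> carrier G \<and> spherical G S T}"

text \<open>Simplices of Sigma: nonempty finite chains (w.r.t. inclusion) of spherical cosets.
  A k-simplex has k+1 vertices.\<close>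
definition davis_simplices :: "'w monoid \<Rightarrow> 'w set \<Rightarrow> 'w set set set" where
  "davis_simplices G S =
     {\<sigma>. \<sigma> \<noteq> {} \<and> finite \<sigma> \<and> \<sigma> \<subseteq> davis_vertices G S \<and>
          (\<forall>u\<in>\<sigma>. \<forall>v\<in>\<sigma>. u \<subseteq> v \<or> v \<subseteq> u)}"

text \<open>The cone vertex b of the base chamber D: the coset W_{} = {1}.\<close>
definition cone_vertex :: "'w monoid \<Rightarrow> 'w set" where
  "cone_vertex G = {\<one>\<^bsub>G\<^esub>}"

text \<open>sigma lies in the chamber wD iff w lies in every coset (vertex) of sigma.
  d(sigma) = min { d(w) : sigma \<subseteq> wD }.\<close>
definition simplex_length :: "'w monoid \<Rightarrow> 'w set \<Rightarrow> 'w set set \<Rightarrow> nat" where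
  "simplex_length G S \<sigma> = (LEAST n. \<exists>w \<in> carrier G. w \<in> \<Inter>\<sigma> \<and> word_length G S w = n)"

section \<open>Chains\<close>

text \<open>Chains are coefficient functions on simplices (real coefficients); simplices are
  oriented by the inclusion order of their vertices.\<close>
type_synonym 'w chain = "'w set set \<Rightarrow> real"

definition simplex_chain :: "'w set set \<Rightarrow> 'w chain" where
  "simplex_chain \<sigma> = (\<lambda>\<tau>. if \<tau> = \<sigma> then 1 else 0)"

text \<open>Finitely supported chains C_*(Sigma).\<close>
definition fin_chains :: "'w monoid \<Rightarrow> 'w set \<Rightarrow> 'w chain set" where
  "fin_chains G S = {c. finite {\<tau>. c \<tau> \<noteq> 0} \<and> {\<tau>. c \<tau> \<noteq> 0} \<subseteq> davis_simplices G S}"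

text \<open>Finitely supported k-chains C_k(Sigma).\<close>
definition fin_kchains :: "'w monoid \<Rightarrow> 'w set \<Rightarrow> nat \<Rightarrow> 'w chain set" where
  "fin_kchains G S k = {c \<in> fin_chains G S. \<forall>\<tau>. c \<tau> \<noteq> 0 \<longrightarrow> card \<tau> = Suc k}"

text \<open>Incidence sign [sigma : tau] for a codimension-one face tau of sigma: if sigma is
  v_0 < ... < v_k and tau omits v_i, the sign is (-1)^i.\<close>
definition incidence :: "'w set set \<Rightarrow> 'w set set \<Rightarrow> real" where
  "incidence \<sigma> \<tau> = (-1) ^ card {u \<in> \<sigma>. u \<subset> the_elem (\<sigma> - \<tau>)}"

text \<open>The usual simplicial boundary of a finitely supported chain.\<close>
definition boundary :: "'w monoid \<Rightarrow> 'w set \<Rightarrow> 'w chain \<Rightarrow> 'w chain" where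
  "boundary G S c = (\<lambda>\<tau>. if \<tau> \<in> davis_simplices G S then
       (\<Sum>\<sigma> \<in> {\<sigma> \<in> davis_simplices G S. \<tau> \<subset> \<sigma> \<and> card \<sigma> = Suc (card \<tau>) \<and> c \<sigma> \<noteq> 0}.
           incidence \<sigma> \<tau> * c \<sigma>)
     else 0)"

text \<open>The weighted L^2 space L^2_t C_*(Sigma) and its norm.\<close>
definition l2t_chains :: "'w monoid \<Rightarrow> 'w set \<Rightarrow> real \<Rightarrow> 'w chain set" where
  "l2t_chains G S t = {c. {\<tau>. c \<tau> \<noteq> 0} \<subseteq> davis_simplices G S \<and>
     (\<lambda>\<tau>. (c \<tau>)\<^sup>2 * t ^ simplex_length G S \<tau>) summable_on davis_simplices G S}"

definition l2t_norm :: "'w monoid \<Rightarrow> 'w set \<Rightarrow> real \<Rightarrow> 'w chain \<Rightarrow> real" where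
  "l2t_norm G S t c = sqrt (\<Sum>\<^sub>\<infinity>\<tau> \<in> davis_simplices G S. (c \<tau>)\<^sup>2 * t ^ simplex_length G S \<tau>)"

section \<open>Geometric realization and piecewise Euclidean metrics\<close>

text \<open>Points of |Sigma| in barycentric coordinates: functions on vertices.\<close>
type_synonym 'w point = "'w set \<Rightarrow> real"

definition closed_simplex :: "'w set set \<Rightarrow> 'w point set" where
  "closed_simplex \<sigma> = {p. (\<forall>v. 0 \<le> p v) \<and> (\<forall>v. v \<notin> \<sigma> \<longrightarrow> p v = 0) \<and> (\<Sum>v\<in>\<sigma>. p v) = 1}"

definition davis_points :: "'w monoid \<Rightarrow> 'w set \<Rightarrow> 'w point set" where
  "davis_points G S = (\<Union>\<sigma> \<in> davis_simplices G S. closed_simplex \<sigma>)"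

definition vertex_point :: "'w set \<Rightarrow> 'w point" where
  "vertex_point v = (\<lambda>u. if u = v then 1 else 0)"

text \<open>A piecewise Euclidean structure on Sigma given by edge lengths l: every simplex,
  with the edge lengths l, is isometric to a nondegenerate Euclidean simplex, i.e. its
  vertices can be placed affinely independently in some R^N with the prescribed
  distances.\<close>
definition pe_edge_lengths :: "'w monoid \<Rightarrow> 'w set \<Rightarrow> ('w set \<Rightarrow> 'w set \<Rightarrow> real) \<Rightarrow> bool" where
  "pe_edge_lengths G S l \<longleftrightarrow>
     (\<forall>\<sigma> \<in> davis_simplices G S. \<exists>(N::nat) (x :: 'w set \<Rightarrow> nat \<Rightarrow> real).
        (\<forall>v\<in>\<sigma>. \<forall>u\<in>\<sigma>. l v u = sqrt (\<Sum>i<N. (x v i - x u i)\<^sup>2)) \<and>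
        (\<forall>a :: 'w set \<Rightarrow> real. (\<Sum>v\<in>\<sigma>. a v) = 0 \<longrightarrow>
            (\<forall>i<N. (\<Sum>v\<in>\<sigma>. a v * x v i) = 0) \<longrightarrow> (\<forall>v\<in>\<sigma>. a v = 0)))"

text \<open>Euclidean distance inside a simplex with edge lengths l, for barycentric points
  p, q (the Euclidean distance of the corresponding points of a realizing Euclidean
  simplex, written via the classical formula
  |sum_v u_v x_v|^2 = -1/2 sum_{v,w} u_v u_w |x_v - x_w|^2  for sum_v u_v = 0).\<close>
definition simplex_dist :: "('w set \<Rightarrow> 'w set \<Rightarrow> real) \<Rightarrow> 'w set set \<Rightarrow> 'w point \<Rightarrow> 'w point \<Rightarrow> real" where
  "simplex_dist l \<sigma> p q =
     sqrt (- (1/2) * (\<Sum>v\<in>\<sigma>. \<Sum>u\<in>\<sigma>. (p v - q v) * (p u - q u) * (l v u)\<^sup>2))"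

text \<open>The intrinsic (length) metric of the piecewise Euclidean complex: infimum of lengths
  of strings x_0 = p, ..., x_n = q with consecutive points in a common closed simplex.\<close>
definition pe_dist :: "'w monoid \<Rightarrow> 'w set \<Rightarrow> ('w set \<Rightarrow> 'w set \<Rightarrow> real) \<Rightarrow> 'w point \<Rightarrow> 'w point \<Rightarrow> real" where
  "pe_dist G S l p q = Inf {(\<Sum>i<n. simplex_dist l (\<sigma>s ! i) (xs ! i) (xs ! Suc i)) | n xs \<sigma>s.
       length xs = Suc n \<and> length \<sigma>s = n \<and> xs ! 0 = p \<and> xs ! n = q \<and>
       (\<forall>i<n. \<sigma>s ! i \<in> davis_simplices G S \<and> xs ! i \<in> closed_simplex (\<sigma>s ! i) \<and>
              xs ! Suc i \<in> closed_simplex (\<sigma>s ! i))}"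

text \<open>W-invariance of the edge lengths (W acts on vertices by left translation of cosets).\<close>
definition W_invariant_lengths :: "'w monoid \<Rightarrow> 'w set \<Rightarrow> ('w set \<Rightarrow> 'w set \<Rightarrow> real) \<Rightarrow> bool" where
  "W_invariant_lengths G S l \<longleftrightarrow>
     (\<forall>w \<in> carrier G. \<forall>u \<in> davis_vertices G S. \<forall>v \<in> davis_vertices G S.
        l (w <#\<^bsub>G\<^esub> u) (w <#\<^bsub>G\<^esub> v) = l u v)"

section \<open>Geodesics and CAT(0)\<close>

text \<open>g : [0, d a b] -> X is a (unit speed) geodesic from a to b.\<close>
definition geodesic_from_to :: "'p set \<Rightarrow> ('p \<Rightarrow> 'p \<Rightarrow> real) \<Rightarrow> (real \<Rightarrow> 'p) \<Rightarrow> 'p \<Rightarrow> 'p \<Rightarrow> bool" where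
  "geodesic_from_to X d g a b \<longleftrightarrow>
     g 0 = a \<and> g (d a b) = b \<and> (\<forall>s \<in> {0..d a b}. g s \<in> X) \<and>
     (\<forall>s \<in> {0..d a b}. \<forall>s' \<in> {0..d a b}. d (g s) (g s') = \<bar>s - s'\<bar>)"

definition is_metric_on :: "'p set \<Rightarrow> ('p \<Rightarrow> 'p \<Rightarrow> real) \<Rightarrow> bool" where
  "is_metric_on X d \<longleftrightarrow>
     (\<forall>x\<in>X. \<forall>y\<in>X. 0 \<le> d x y \<and> (d x y = 0 \<longleftrightarrow> x = y) \<and> d x y = d y x) \<and>
     (\<forall>x\<in>X. \<forall>y\<in>X. \<forall>z\<in>X. d x z \<le> d x y + d y z)"

text \<open>Points of one side of a geodesic triangle paired with their comparison points in
  the Euclidean plane (modelled as the complex numbers).\<close>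
definition side_pairs :: "('p \<Rightarrow> 'p \<Rightarrow> real) \<Rightarrow> (real \<Rightarrow> 'p) \<Rightarrow> 'p \<Rightarrow> 'p \<Rightarrow> complex \<Rightarrow> complex \<Rightarrow> ('p \<times> complex) set" where
  "side_pairs d g a b a' b' =
     {(g s, a' + complex_of_real (s / d a b) * (b' - a')) | s. s \<in> {0..d a b}}"

text \<open>CAT(0): a geodesic metric space in which every geodesic triangle satisfies the
  CAT(0) comparison inequality against its Euclidean comparison triangle.\<close>
definition CAT0 :: "'p set \<Rightarrow> ('p \<Rightarrow> 'p \<Rightarrow> real) \<Rightarrow> bool" where
  "CAT0 X d \<longleftrightarrow> is_metric_on X d \<and>
     (\<forall>a\<in>X. \<forall>b\<in>X. \<exists>g. geodesic_from_to X d g a b) \<and>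
     (\<forall>x\<in>X. \<forall>y\<in>X. \<forall>z\<in>X. \<forall>g1 g2 g3 x' y' z'.
        geodesic_from_to X d g1 x y \<and> geodesic_from_to X d g2 y z \<and> geodesic_from_to X d g3 z x \<and>
        cmod (x' - y') = d x y \<and> cmod (y' - z') = d y z \<and> cmod (z' - x') = d z x \<longrightarrow>
        (let P = side_pairs d g1 x y x' y' \<union> side_pairs d g2 y z y' z' \<union> side_pairs d g3 z x z' x'
         in \<forall>(p, p') \<in> P. \<forall>(q, q') \<in> P. d p q \<le> cmod (p' - q')))"

text \<open>The chamber wD as a subset of |Sigma|.\<close>
definition chamber_points :: "'w monoid \<Rightarrow> 'w set \<Rightarrow> 'w \<Rightarrow> 'w point set" where
  "chamber_points G S w =
     (\<Union>\<sigma> \<in> {\<sigma> \<in> davis_simplices G S. w \<in> \<Inter>\<sigma>}. closed_simplex \<sigma>)"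

text \<open>Every ball of radius r meets at most N(r) chambers.\<close>
definition balls_meet_boundedly_many_chambers :: "'w monoid \<Rightarrow> 'w set \<Rightarrow> ('w point \<Rightarrow> 'w point \<Rightarrow> real) \<Rightarrow> bool" where
  "balls_meet_boundedly_many_chambers G S d \<longleftrightarrow>
     (\<forall>r. \<exists>N::nat. \<forall>p \<in> davis_points G S.
        finite {w \<in> carrier G. \<exists>x \<in> chamber_points G S w. d p x < r} \<and>
        card {w \<in> carrier G. \<exists>x \<in> chamber_points G S w. d p x < r} \<le> N)"

text \<open>The hypothesis on the Moussong metric used in the paper: d_M is the intrinsic metric
  of a W-invariant piecewise Euclidean structure on Sigma, it is CAT(0), and balls of
  radius r meet at most N(r) chambers.\<close>
definition moussong_type_metric :: "'w monoid \<Rightarrow> 'w set \<Rightarrow> ('w point \<Rightarrow> 'w point \<Rightarrow> real) \<Rightarrow> bool" where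
  "moussong_type_metric G S dM \<longleftrightarrow>
     (\<exists>l. pe_edge_lengths G S l \<and> W_invariant_lengths G S l \<and> dM = pe_dist G S l) \<and>
     CAT0 (davis_points G S) dM \<and> balls_meet_boundedly_many_chambers G S dM"

end

theory Submission
  imports Defs
begin

text \<open>Fix a simplex \<open>\<sigma>\<close> in a chamber \<open>w'D\<close>. If \<open>\<tau> \<subseteq> wD\<close> lies in the support of \<open>H(\<sigma>)\<close>,
  then \<open>wD\<close> is near a geodesic from \<open>\<sigma>\<close> to \<open>b\<close>. Folding along a wall does not increase distances,
  so a geodesic of the CAT(0) space \<open>\<Sigma>\<close> crosses no wall twice; as word length counts separating
  walls, \<open>d(w') = d(w) + n\<close> up to a bounded error, where \<open>n = d(w\<^sup>-\<^sup>1w')\<close>, and for given \<open>\<sigma>\<close> and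
  \<open>n\<close> only boundedly many \<open>\<tau>\<close> occur. For given \<open>\<tau>\<close> and \<open>n\<close> the number of \<open>\<sigma>\<close> is at most a
  constant times the \<open>n\<close>-th coefficient of the growth series. Hence the Schur test with weights
  \<open>\<beta>\<^sup>n\<close>, where \<open>1/t < \<beta> < \<rho>\<close>, applies: row sums are bounded by the growth series at \<open>\<beta>\<close>,
  column sums by a geometric series in \<open>1/(t\<beta>)\<close>.\<close>

subsection \<open>Word length and walls\<close>


text \<open>A wall is encoded by a group element \<open>r\<close>, and crossing it by a parity
  defined for every \<open>r\<close>, so the reflections need not be singled out. What replaces
  "lying on the wall" is that a point common to chambers on both sides of \<open>r\<close> is fixed
  by \<open>r\<close>. This makes folding well defined chamber by chamber, and it also explains the
  bounded error: a wall met on both sides of a point \<open>x\<close> of a geodesic must fix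
  \<open>x\<close>, and the ball condition bounds the number of chambers containing
  \<open>x\<close>, hence the number of such walls. The weights follow. A suitable \<beta> exists
  exactly when t > 1/\<rho>.\<close>

lemma word_prod_Nil [simp]: "word_prod G [] = \<one>\<^bsub>G\<^esub>"
  and word_prod_Cons [simp]: "word_prod G (s # ws) = s \<otimes>\<^bsub>G\<^esub> word_prod G ws"
  by (simp_all add: word_prod_def)

text \<open>The parity of the number of times the gallery spelled by a word crosses the wall of a reflection \<open>r\<close>.\<close>
primrec wall_parity :: "'w monoid \<Rightarrow> 'w list \<Rightarrow> 'w \<Rightarrow> bool" where
  "wall_parity G [] r \<longleftrightarrow> False"
| "wall_parity G (s # ws) r \<longleftrightarrow> (r = s) \<noteq> wall_parity G ws (s \<otimes>\<^bsub>G\<^esub> r \<otimes>\<^bsub>G\<^esub> s)"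

locale coxeter =
  fixes G :: "'w monoid" (structure) and S :: "'w set"
  assumes cox: "coxeter_system G S"
begin

sublocale group G
  using cox by (simp add: coxeter_system_def)

lemma finite_S: "finite S" and S_carrier: "S \<subseteq> carrier G" and gen_S: "generate G S = carrier G"
  using cox by (auto simp: coxeter_system_def)

lemma S_closed: "s \<in> S \<Longrightarrow> s \<in> carrier G"
  using S_carrier by blast

lemma S_square: "s \<in> S \<Longrightarrow> s \<otimes> s = \<one>"
  using cox by (auto simp: coxeter_system_def)

lemma S_cancel: "s \<in> S \<Longrightarrow> r \<in> carrier G \<Longrightarrow> s \<otimes> (s \<otimes> r) = r"
  using S_square S_closed by (metis l_one m_assoc)

lemma S_inv: "s \<in> S \<Longrightarrow> inv s = s"
  using S_square S_closed by (simp add: inv_equality)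

lemma word_prod_closed: "set ws \<subseteq> S \<Longrightarrow> word_prod G ws \<in> carrier G"
  by (induction ws) (auto simp: S_closed)

lemma word_prod_append:
  "set us \<subseteq> S \<Longrightarrow> set vs \<subseteq> S \<Longrightarrow> word_prod G (us @ vs) = word_prod G us \<otimes> word_prod G vs"
  by (induction us) (auto simp: S_closed word_prod_closed m_assoc)

lemma word_prod_rev: "set ws \<subseteq> S \<Longrightarrow> word_prod G (rev ws) = inv (word_prod G ws)"
  by (induction ws)
     (auto simp: S_closed word_prod_closed word_prod_append inv_mult_group S_inv)

lemma generate_word:
  assumes "T \<subseteq> S" "w \<in> generate G T"
  obtains ws where "set ws \<subseteq> T" "word_prod G ws = w"
proof -
  have "\<exists>ws. set ws \<subseteq> T \<and> word_prod G ws = w"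
    using assms(2)
  proof (induction rule: generate.induct)
    case one
    show ?case by (rule exI[of _ "[]"]) simp
  next
    case (incl h)
    then show ?case using assms(1) S_closed by (intro exI[of _ "[h]"]) auto
  next
    case (inv h)
    then have "h \<in> S" using assms(1) by auto
    then show ?case using inv S_closed S_inv by (intro exI[of _ "[h]"]) auto
  next
    case (eng h1 h2)
    then obtain us vs where "set us \<subseteq> T" "word_prod G us = h1" "set vs \<subseteq> T" "word_prod G vs = h2"
      by blast
    then show ?case using assms(1) by (intro exI[of _ "us @ vs"]) (auto simp: word_prod_append)
  qed
  then show ?thesis using that by blast
qed

lemma carrier_word:
  assumes "w \<in> carrier G"
  obtains ws where "set ws \<subseteq> S" "word_prod G ws = w"
  using generate_word[of S w] assms gen_S by blast

text \<open>Cocycle identity: after the letters \<open>us\<close> the gallery has been translated by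
  \<open>word_prod G us\<close>, so the remaining letters meet the wall \<open>r\<close> where an
  untranslated gallery would meet its conjugate.\<close>

lemma wall_parity_append:
  assumes "set us \<subseteq> S" "r \<in> carrier G"
  shows "wall_parity G (us @ vs) r \<longleftrightarrow>
    wall_parity G us r \<noteq> wall_parity G vs (inv (word_prod G us) \<otimes> r \<otimes> word_prod G us)"
  using assms
proof (induction us arbitrary: r)
  case Nil
  then show ?case by simp
next
  case (Cons s us)
  then have c: "s \<in> S" "s \<in> carrier G" "word_prod G us \<in> carrier G" "r \<in> carrier G"
    by (auto simp: S_closed word_prod_closed)
  have "inv (s \<otimes> word_prod G us) \<otimes> r \<otimes> (s \<otimes> word_prod G us)
      = inv (word_prod G us) \<otimes> (s \<otimes> r \<otimes> s) \<otimes> word_prod G us"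
    using c by (simp add: inv_mult_group S_inv m_assoc)
  then show ?case using Cons c by auto
qed

section \<open>Dihedral words and the Coxeter relators\<close>

lemma conj_eq_iff:
  assumes "p \<in> carrier G" "r \<in> carrier G" "s \<in> carrier G"
  shows "inv p \<otimes> r \<otimes> p = s \<longleftrightarrow> r = p \<otimes> s \<otimes> inv p"
proof
  assume "inv p \<otimes> r \<otimes> p = s"
  then have "p \<otimes> s \<otimes> inv p = p \<otimes> (inv p \<otimes> (r \<otimes> (p \<otimes> inv p)))"
    using assms by (metis inv_closed m_assoc m_closed)
  then show "r = p \<otimes> s \<otimes> inv p" using assms by (simp add: m_assoc[symmetric])
next
  assume "r = p \<otimes> s \<otimes> inv p"
  then show "inv p \<otimes> r \<otimes> p = s"
    using assms by (simp add: m_assoc) (metis inv_closed l_inv l_one m_assoc)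
qed

text \<open>The involution \<open>s\<close> conjugates \<open>s \<otimes> s'\<close> to its inverse;
  moving it past the inverse power doubles the exponent.\<close>

lemma dihedral_conj:
  assumes "s \<in> S" "s' \<in> S"
  shows "(s \<otimes> s') [^] (k::nat) \<otimes> s \<otimes> inv ((s \<otimes> s') [^] k) = (s \<otimes> s') [^] (2 * k) \<otimes> s"
proof -
  let ?p = "s \<otimes> s'"
  have c: "s \<in> carrier G" "s' \<in> carrier G" "?p \<in> carrier G" using assms S_closed by auto
  have ip: "inv ?p = s' \<otimes> s" using assms c by (simp add: inv_mult_group S_inv)
  have "s \<otimes> inv (?p [^] k) = ?p [^] k \<otimes> s"
  proof (induction k)
    case 0
    then show ?case using c by simp
  next
    case (Suc k)
    have "s \<otimes> inv (?p [^] Suc k) = s \<otimes> inv ?p \<otimes> inv (?p [^] k)"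
      using c by (simp add: inv_mult_group m_assoc)
    also have "s \<otimes> inv ?p = ?p \<otimes> s" using c ip by (simp add: m_assoc)
    also have "?p \<otimes> s \<otimes> inv (?p [^] k) = ?p \<otimes> (?p [^] k \<otimes> s)" using Suc c by (simp add: m_assoc)
    also have "\<dots> = ?p [^] Suc k \<otimes> s" using c nat_pow_Suc2[of ?p k] by (simp add: m_assoc)
    finally show ?case .
  qed
  then have "?p [^] k \<otimes> s \<otimes> inv (?p [^] k) = ?p [^] k \<otimes> ?p [^] k \<otimes> s"
    using c by (simp add: m_assoc)
  then show ?thesis using c by (simp add: nat_pow_mult mult_2)
qed

lemma word_prod_dihedral:
  "s \<in> S \<Longrightarrow> s' \<in> S \<Longrightarrow> word_prod G (concat (replicate k [s, s'])) = (s \<otimes> s') [^] k"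
proof (induction k)
  case (Suc k)
  then show ?case using S_closed nat_pow_Suc2[of "s \<otimes> s'" k] by (simp add: m_assoc)
qed simp

text \<open>The alternating word crosses the walls \<open>(s \<otimes> s') [^] j \<otimes> s\<close>
  for j < 2k one after the other. Indices are counted rather than reflections, since the latter
  repeat when \<open>s \<otimes> s'\<close> has finite order.\<close>

lemma wall_parity_dihedral:
  assumes "s \<in> S" "s' \<in> S" "r \<in> carrier G"
  shows "wall_parity G (concat (replicate k [s, s'])) r \<longleftrightarrow>
    odd (card {j. j < 2 * k \<and> r = (s \<otimes> s') [^] j \<otimes> s})"
proof (induction k)
  case 0
  then show ?case by simp
next
  case (Suc k)
  let ?p = "(s \<otimes> s') [^] k" and ?P = "\<lambda>j. r = (s \<otimes> s') [^] (j::nat) \<otimes> s"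
  have c: "s \<in> carrier G" "s' \<in> carrier G" "?p \<in> carrier G" using assms S_closed by auto
  have cc: "inv ?p \<otimes> r \<otimes> ?p \<in> carrier G" using c assms by simp
  have 1: "inv ?p \<otimes> r \<otimes> ?p = s \<longleftrightarrow> ?P (2 * k)"
    using c assms by (simp add: conj_eq_iff dihedral_conj)
  \<comment> \<open>The second letter of the last pair is met after \<open>s\<close>. Its wall has
    the odd index, because \<open>?p\<close> commutes with \<open>s \<otimes> s'\<close> and so one
    extra factor \<open>s \<otimes> s'\<close> comes out in front.\<close>
  have "s \<otimes> (inv ?p \<otimes> r \<otimes> ?p) \<otimes> s = s' \<longleftrightarrow> inv ?p \<otimes> r \<otimes> ?p = s \<otimes> s' \<otimes> s"
    using conj_eq_iff[of s "inv ?p \<otimes> r \<otimes> ?p" s'] cc c assms by (simp add: S_inv)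
  also have "\<dots> \<longleftrightarrow> r = ?p \<otimes> (s \<otimes> s' \<otimes> s) \<otimes> inv ?p"
    using c assms by (simp add: conj_eq_iff)
  also have "?p \<otimes> (s \<otimes> s' \<otimes> s) \<otimes> inv ?p = (s \<otimes> s') \<otimes> (?p \<otimes> s \<otimes> inv ?p)"
  proof -
    have "?p \<otimes> (s \<otimes> s') = (s \<otimes> s') \<otimes> ?p"
      using c nat_pow_Suc2[of "s \<otimes> s'" k] by simp
    then have "?p \<otimes> (s \<otimes> s') \<otimes> (s \<otimes> inv ?p) = (s \<otimes> s') \<otimes> ?p \<otimes> (s \<otimes> inv ?p)" by simp
    then show ?thesis using c by (simp add: m_assoc)
  qed
  also have "\<dots> = (s \<otimes> s') [^] Suc (2 * k) \<otimes> s"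
    unfolding dihedral_conj[OF assms(1,2)]
    using c nat_pow_Suc2[of "s \<otimes> s'" "2 * k"] by (simp add: m_assoc)
  finally have 2: "s \<otimes> (inv ?p \<otimes> r \<otimes> ?p) \<otimes> s = s' \<longleftrightarrow> ?P (Suc (2 * k))" .
  have "replicate (Suc k) [s, s'] = replicate k [s, s'] @ [[s, s']]"
    by (metis replicate_Suc replicate_append_same)
  then have "wall_parity G (concat (replicate (Suc k) [s, s'])) r \<longleftrightarrow>
      wall_parity G (concat (replicate k [s, s'])) r \<noteq> wall_parity G [s, s'] (inv ?p \<otimes> r \<otimes> ?p)"
    using wall_parity_append[of "concat (replicate k [s, s'])" r "[s, s']"] assms
    by (simp add: word_prod_dihedral)
  also have "\<dots> \<longleftrightarrow> odd (card {j. j < 2 * k \<and> ?P j}) \<noteq> (?P (2 * k) \<noteq> ?P (Suc (2 * k)))"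
    using Suc 1 2 by auto
  also have "\<dots> \<longleftrightarrow> odd (card {j. j < 2 * Suc k \<and> ?P j})"
  proof -
    have f: "finite {j. j < n \<and> ?P j}" for n :: nat by simp
    have step: "odd (card {j. j < Suc n \<and> ?P j}) \<longleftrightarrow> odd (card {j. j < n \<and> ?P j}) \<noteq> ?P n" for n :: nat
    proof -
      have "{j. j < Suc n \<and> ?P j} = (if ?P n then insert n {j. j < n \<and> ?P j} else {j. j < n \<and> ?P j})"
        by (auto simp: less_Suc_eq)
      then show ?thesis by auto
    qed
    have "2 * Suc k = Suc (Suc (2 * k))" by simp
    then show ?thesis using step[of "2 * k"] step[of "Suc (2 * k)"] by (simp only:) blast
  qed
  finally show ?case .
qed

text \<open>With m the order of \<open>s \<otimes> s'\<close>, the relator has 2m letters, and the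
  indices \<open>j\<close> and \<open>m + j\<close> give the same reflection; so every wall is
  crossed an even number of times. For equal generators m is 1.\<close>

lemma relator_word:
  assumes "rel \<in> coxeter_relators G S"
  shows "set rel \<subseteq> S" "word_prod G rel = \<one>" "r \<in> carrier G \<Longrightarrow> \<not> wall_parity G rel r"
proof -
  obtain s s' where ss: "s \<in> S" "s' \<in> S"
    and rel: "rel = concat (replicate (ord (s \<otimes> s')) [s, s'])"
    using assms by (auto simp: coxeter_relators_def)
  have c: "s \<in> carrier G" "s' \<in> carrier G" using ss S_closed by auto
  show "set rel \<subseteq> S" using ss rel by auto
  show "word_prod G rel = \<one>" using ss c rel by (simp add: word_prod_dihedral)
  assume r: "r \<in> carrier G"
  define m where "m = ord (s \<otimes> s')"
  define A where "A = {j. j < m \<and> r = (s \<otimes> s') [^] j \<otimes> s}"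
  have per: "(s \<otimes> s') [^] (m + j) = (s \<otimes> s') [^] j" for j :: nat
    using c by (simp add: m_def nat_pow_mult[symmetric])
  have "{j. j < 2 * m \<and> r = (s \<otimes> s') [^] j \<otimes> s} = A \<union> (+) m ` A"
  proof (intro equalityI subsetI)
    fix j assume j: "j \<in> {j. j < 2 * m \<and> r = (s \<otimes> s') [^] j \<otimes> s}"
    show "j \<in> A \<union> (+) m ` A"
    proof (cases "j < m")
      case False
      then have "j = m + (j - m)" by simp
      moreover have "j - m \<in> A" using j False per[of "j - m"] by (auto simp: A_def)
      ultimately show ?thesis by blast
    qed (use j in \<open>auto simp: A_def\<close>)
  qed (auto simp: A_def per)
  moreover have "card (A \<union> (+) m ` A) = card A + card ((+) m ` A)"
    by (rule card_Un_disjoint) (auto simp: A_def)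
  moreover have "card ((+) m ` A) = card A" by (simp add: card_image)
  ultimately show "\<not> wall_parity G rel r"
    using wall_parity_dihedral[OF ss r, of m] rel by (simp add: m_def)
qed

section \<open>Crossing parity as a function on the group\<close>

lemma wall_parity_relator_step:
  assumes "(x, y) \<in> relator_step G S" "r \<in> carrier G" "set y \<subseteq> S"
  shows "wall_parity G x r \<longleftrightarrow> wall_parity G y r"
proof -
  obtain u q v where x: "x = u @ q @ v" and y: "y = u @ v" and q: "q \<in> coxeter_relators G S"
    using assms by (auto simp: relator_step_def)
  have uv: "set u \<subseteq> S" "set v \<subseteq> S" using assms y by auto
  let ?r = "inv (word_prod G u) \<otimes> r \<otimes> word_prod G u"
  have c: "?r \<in> carrier G" using uv assms by (simp add: word_prod_closed)
  have "wall_parity G (q @ v) ?r \<longleftrightarrow> wall_parity G v ?r"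
    using wall_parity_append[of q ?r v] relator_word[OF q] c by simp
  then show ?thesis using uv assms x y wall_parity_append[of u r] by simp
qed

text \<open>Here the presentation enters: inserting or deleting a relator changes no parity, and the
  empty word crosses nothing.\<close>

lemma wall_parity_unit:
  assumes "set ws \<subseteq> S" "word_prod G ws = \<one>" "r \<in> carrier G"
  shows "\<not> wall_parity G ws r"
proof -
  have "(ws, []) \<in> (relator_step G S \<union> (relator_step G S)\<inverse>)\<^sup>*"
    using cox assms by (simp add: coxeter_system_def)
  \<comment> \<open>A relator step allows arbitrary letters around the relator. That all words stay
    over \<open>S\<close> is therefore carried through the induction, which starts at the empty
    word.\<close>
  then have "set ws \<subseteq> S \<and> \<not> wall_parity G ws r"
  proof (induction rule: converse_rtrancl_induct)
    case (step x y)
    then consider "(x, y) \<in> relator_step G S" | "(y, x) \<in> relator_step G S" by blast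
    then show ?case
    proof cases
      case 1
      then obtain u q v where "x = u @ q @ v" "y = u @ v" "q \<in> coxeter_relators G S"
        by (auto simp: relator_step_def)
      then have "set x \<subseteq> S" using step.IH relator_word(1)[of q] by simp
      then show ?thesis using wall_parity_relator_step[OF 1] step assms by blast
    next
      case 2
      then obtain u q v where "y = u @ q @ v" "x = u @ v" by (auto simp: relator_step_def)
      then have "set x \<subseteq> S" using step.IH by simp
      then show ?thesis using wall_parity_relator_step[OF 2] step assms by blast
    qed
  qed simp
  then show ?thesis by simp
qed

text \<open>Both \<open>us @ rev vs\<close> and \<open>vs @ rev vs\<close> spell the identity, and
  by the cocycle identity the common tail contributes the same parity to both.\<close>

lemma wall_parity_cong:
  assumes "set us \<subseteq> S" "set vs \<subseteq> S" "word_prod G us = word_prod G vs" "r \<in> carrier G"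
  shows "wall_parity G us r \<longleftrightarrow> wall_parity G vs r"
proof -
  have "\<not> wall_parity G (us @ rev vs) r" "\<not> wall_parity G (vs @ rev vs) r"
    by (rule wall_parity_unit;
        use assms in \<open>simp add: word_prod_append word_prod_rev word_prod_closed\<close>)+
  then show ?thesis using assms by (simp add: wall_parity_append)
qed

text \<open>The elements \<open>r\<close> with \<open>side w r\<close> form the inversion set of
  \<open>w\<close>: the reflections whose walls separate the base chamber from \<open>wD\<close>.
  The chosen word is immaterial by \<open>wall_parity_cong\<close>.\<close>

definition side :: "'w \<Rightarrow> 'w \<Rightarrow> bool" where
  "side w r = wall_parity G (SOME ws. set ws \<subseteq> S \<and> word_prod G ws = w) r"

lemma side_word:
  assumes "set ws \<subseteq> S" "r \<in> carrier G"
  shows "side (word_prod G ws) r \<longleftrightarrow> wall_parity G ws r"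
proof -
  have "\<exists>us. set us \<subseteq> S \<and> word_prod G us = word_prod G ws" using assms by blast
  from someI_ex[OF this] show ?thesis
    unfolding side_def using assms by (intro wall_parity_cong) auto
qed

lemma side_mult:
  assumes "u \<in> carrier G" "w \<in> carrier G" "r \<in> carrier G"
  shows "side (u \<otimes> w) r \<longleftrightarrow> side u r \<noteq> side w (inv u \<otimes> r \<otimes> u)"
proof -
  obtain us ws where w: "set us \<subseteq> S" "word_prod G us = u" "set ws \<subseteq> S" "word_prod G ws = w"
    using assms carrier_word by metis
  have "side (u \<otimes> w) r \<longleftrightarrow> wall_parity G (us @ ws) r"
    using side_word[of "us @ ws" r] w assms by (auto simp: word_prod_append)
  then show ?thesis
    using w assms side_word[of us r] side_word[of ws "inv u \<otimes> r \<otimes> u"] by (simp add: wall_parity_append)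
qed

text \<open>The strong exchange condition. Conjugating \<open>r\<close> along the word leads to the
  first letter at which its wall is crossed; multiplication by \<open>r\<close> cancels just that
  letter.\<close>

lemma wall_parity_exchange:
  assumes "set ws \<subseteq> S" "r \<in> carrier G" "wall_parity G ws r"
  shows "\<exists>vs. set vs \<subseteq> S \<and> Suc (length vs) = length ws \<and> r \<otimes> word_prod G ws = word_prod G vs"
  using assms
proof (induction ws arbitrary: r)
  case (Cons s ws)
  then have c: "s \<in> S" "s \<in> carrier G" "word_prod G ws \<in> carrier G"
    by (auto simp: S_closed word_prod_closed)
  show ?case
  proof (cases "r = s")
    case True
    then show ?thesis using Cons c by (intro exI[of _ ws]) (auto simp: S_cancel)
  next
    case False
    then obtain vs where vs: "set vs \<subseteq> S" "Suc (length vs) = length ws"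
        "s \<otimes> r \<otimes> s \<otimes> word_prod G ws = word_prod G vs"
      using Cons.IH[of "s \<otimes> r \<otimes> s"] Cons.prems c by auto
    have "s \<otimes> word_prod G vs = r \<otimes> (s \<otimes> word_prod G ws)"
      unfolding vs(3)[symmetric] using c Cons.prems by (simp add: m_assoc S_cancel)
    then show ?thesis using vs c by (intro exI[of _ "s # vs"]) auto
  qed
qed simp

section \<open>Word length as a number of walls\<close>

abbreviation len :: "'w \<Rightarrow> nat" where "len \<equiv> word_length G S"

lemma len_le: "set ws \<subseteq> S \<Longrightarrow> len (word_prod G ws) \<le> length ws"
  unfolding word_length_def by (rule Least_le) blast

lemma len_word:
  assumes "w \<in> carrier G"
  obtains ws where "set ws \<subseteq> S" "length ws = len w" "word_prod G ws = w"
proof -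
  have "\<exists>n. \<exists>ws. set ws \<subseteq> S \<and> length ws = n \<and> word_prod G ws = w"
    using carrier_word[OF assms] by metis
  from LeastI_ex[OF this] show ?thesis using that unfolding word_length_def by blast
qed

text \<open>A reduced word crosses no wall twice: if the tail crossed the wall of the first letter
  \<open>s\<close>, exchange would shorten the word. So the walls of \<open>s # ws\<close> are
  \<open>s\<close> and the conjugates by \<open>s\<close> of those of \<open>ws\<close>, without
  overlap.\<close>

lemma card_wall_parity:
  assumes "set ws \<subseteq> S" "length ws = len (word_prod G ws)"
  shows "finite {r \<in> carrier G. wall_parity G ws r} \<and> card {r \<in> carrier G. wall_parity G ws r} = length ws"
  using assms
proof (induction ws)
  case (Cons s ws)
  let ?A = "{r \<in> carrier G. wall_parity G ws r}"
  have c: "s \<in> S" "s \<in> carrier G" "set ws \<subseteq> S" "word_prod G ws \<in> carrier G"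
    using Cons.prems by (auto simp: S_closed word_prod_closed)
  have red: "length ws = len (word_prod G ws)"
  proof -
    obtain vs where "set vs \<subseteq> S" "length vs = len (word_prod G ws)" "word_prod G vs = word_prod G ws"
      using len_word c by metis
    then have "len (word_prod G (s # ws)) \<le> Suc (len (word_prod G ws))"
      using len_le[of "s # vs"] c by simp
    then show ?thesis using Cons.prems len_le[OF c(3)] by simp
  qed
  have ns: "\<not> wall_parity G ws s"
  proof
    assume "wall_parity G ws s"
    then obtain vs where "set vs \<subseteq> S" "Suc (length vs) = length ws" "s \<otimes> word_prod G ws = word_prod G vs"
      using wall_parity_exchange c by blast
    then show False using len_le[of vs] Cons.prems by simp
  qed
  have inv2: "s \<otimes> (s \<otimes> r \<otimes> s) \<otimes> s = r" if "r \<in> carrier G" for r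
    using that c by (simp add: m_assoc S_cancel S_square)
  have sss: "s \<otimes> s \<otimes> s = s" using c by (simp add: S_square)
  have "{r \<in> carrier G. wall_parity G (s # ws) r} = insert s ((\<lambda>r. s \<otimes> r \<otimes> s) ` ?A)"
  proof (intro equalityI subsetI)
    fix r assume r: "r \<in> {r \<in> carrier G. wall_parity G (s # ws) r}"
    show "r \<in> insert s ((\<lambda>r. s \<otimes> r \<otimes> s) ` ?A)"
    proof (cases "r = s")
      case False
      then have "s \<otimes> r \<otimes> s \<in> ?A" using r c by auto
      then show ?thesis using inv2[of r] r by (metis (no_types, lifting) imageI insertCI mem_Collect_eq)
    qed simp
  next
    fix r assume "r \<in> insert s ((\<lambda>r. s \<otimes> r \<otimes> s) ` ?A)"
    then show "r \<in> {r \<in> carrier G. wall_parity G (s # ws) r}"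
    proof
      assume "r \<in> (\<lambda>r. s \<otimes> r \<otimes> s) ` ?A"
      then obtain q where q: "q \<in> carrier G" "wall_parity G ws q" "r = s \<otimes> q \<otimes> s" by auto
      have "r \<noteq> s"
      proof
        assume "r = s"
        then have "q = s \<otimes> s \<otimes> s" using inv2[OF q(1)] q(3) by simp
        then show False using ns q sss by simp
      qed
      then show ?thesis using q c inv2[OF q(1)] by simp
    qed (use c ns sss in simp)
  qed
  moreover have "s \<notin> (\<lambda>r. s \<otimes> r \<otimes> s) ` ?A"
  proof
    assume "s \<in> (\<lambda>r. s \<otimes> r \<otimes> s) ` ?A"
    then obtain q where q: "q \<in> carrier G" "wall_parity G ws q" "s = s \<otimes> q \<otimes> s" by auto
    then have "q = s" using inv2[OF q(1)] sss by metis
    then show False using ns q by simp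
  qed
  moreover have "inj_on (\<lambda>r. s \<otimes> r \<otimes> s) ?A"
    by (rule inj_on_inverseI[where g = "\<lambda>r. s \<otimes> r \<otimes> s"]) (use inv2 in auto)
  ultimately show ?case using Cons.IH[OF c(3) red] by (simp add: card_image)
qed simp

lemma card_side:
  assumes "w \<in> carrier G"
  shows "finite {r \<in> carrier G. side w r}" "card {r \<in> carrier G. side w r} = len w"
proof -
  obtain ws where ws: "set ws \<subseteq> S" "length ws = len w" "word_prod G ws = w"
    using len_word assms by metis
  have "{r \<in> carrier G. side w r} = {r \<in> carrier G. wall_parity G ws r}"
    using side_word[OF ws(1)] ws(3) by auto
  then show "finite {r \<in> carrier G. side w r}" "card {r \<in> carrier G. side w r} = len w"
    using card_wall_parity[OF ws(1)] ws by auto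
qed

text \<open>A crossed wall is the conjugate of a letter by a product of earlier letters. This will
  show that walls between chambers sharing a vertex stabilize that vertex.\<close>

lemma wall_parity_generate:
  assumes "T \<subseteq> S" "set ws \<subseteq> T" "r \<in> carrier G" "wall_parity G ws r"
  shows "r \<in> generate G T"
  using assms
proof (induction ws arbitrary: r)
  case (Cons s ws)
  then have c: "s \<in> T" "s \<in> S" "s \<in> carrier G" by (auto simp: S_closed)
  show ?case
  proof (cases "r = s")
    case True
    then show ?thesis using c by (simp add: generate.incl)
  next
    case False
    then have "s \<otimes> r \<otimes> s \<in> generate G T" using Cons c by auto
    then have "s \<otimes> (s \<otimes> r \<otimes> s) \<otimes> s \<in> generate G T"
      using c by (blast intro: generate.eng generate.incl)
    moreover have "s \<otimes> (s \<otimes> r \<otimes> s) \<otimes> s = r"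
      using c Cons.prems by (simp add: m_assoc S_cancel S_square)
    ultimately show ?thesis by simp
  qed
qed simp

lemma side_generate:
  assumes "T \<subseteq> S" "w \<in> generate G T" "r \<in> carrier G" "side w r"
  shows "r \<in> generate G T"
proof -
  obtain ws where ws: "set ws \<subseteq> T" "word_prod G ws = w" using generate_word assms by metis
  then show ?thesis
    using wall_parity_generate[OF assms(1) ws(1) assms(3)] side_word[of ws r] assms by auto
qed

section \<open>Separating walls and gallery distance\<close>

definition separating :: "'w \<Rightarrow> 'w \<Rightarrow> 'w set" where
  "separating u w = {r \<in> carrier G. side u r \<noteq> side w r}"

abbreviation wdist :: "'w \<Rightarrow> 'w \<Rightarrow> nat" where "wdist u w \<equiv> len (inv u \<otimes> w)"

lemma separating_iff:
  assumes "u \<in> carrier G" "w \<in> carrier G" "r \<in> carrier G"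
  shows "r \<in> separating u w \<longleftrightarrow> side (inv u \<otimes> w) (inv u \<otimes> r \<otimes> u)"
proof -
  have "u \<otimes> (inv u \<otimes> w) = w" using assms by (simp add: m_assoc[symmetric])
  then show ?thesis using side_mult[of u "inv u \<otimes> w" r] assms by (auto simp: separating_def)
qed

lemma finite_separating: "u \<in> carrier G \<Longrightarrow> w \<in> carrier G \<Longrightarrow> finite (separating u w)"
  by (rule finite_subset[of _ "{r \<in> carrier G. side u r} \<union> {r \<in> carrier G. side w r}"])
     (auto simp: separating_def card_side)

text \<open>Translation by the inverse of \<open>u\<close> moves \<open>u\<close> to the base
  chamber and acts on walls by conjugation; there \<open>card_side\<close> applies.\<close>

lemma card_separating:
  assumes "u \<in> carrier G" "w \<in> carrier G"
  shows "card (separating u w) = wdist u w"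
proof -
  have "bij_betw (\<lambda>r. inv u \<otimes> r \<otimes> u) (separating u w) {r \<in> carrier G. side (inv u \<otimes> w) r}"
  proof (rule bij_betw_byWitness[where f' = "\<lambda>r. u \<otimes> r \<otimes> inv u"])
    have *: "u \<otimes> (inv u \<otimes> r \<otimes> u) \<otimes> inv u = r" if "r \<in> carrier G" for r
      using conj_eq_iff[of u r "inv u \<otimes> r \<otimes> u"] assms that by auto
    have **: "inv u \<otimes> (u \<otimes> r \<otimes> inv u) \<otimes> u = r" if "r \<in> carrier G" for r
      using conj_eq_iff[of u "u \<otimes> r \<otimes> inv u" r] assms that by auto
    show "\<forall>r\<in>separating u w. u \<otimes> (inv u \<otimes> r \<otimes> u) \<otimes> inv u = r"
      using * by (simp add: separating_def)
    show "\<forall>r\<in>{r \<in> carrier G. side (inv u \<otimes> w) r}. inv u \<otimes> (u \<otimes> r \<otimes> inv u) \<otimes> u = r"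
      using ** by simp
    show "(\<lambda>r. inv u \<otimes> r \<otimes> u) ` separating u w \<subseteq> {r \<in> carrier G. side (inv u \<otimes> w) r}"
    proof (rule image_subsetI)
      fix r assume r: "r \<in> separating u w"
      then have "r \<in> carrier G" by (simp add: separating_def)
      then show "inv u \<otimes> r \<otimes> u \<in> {r \<in> carrier G. side (inv u \<otimes> w) r}"
        using r separating_iff[OF assms] assms by simp
    qed
    show "(\<lambda>r. u \<otimes> r \<otimes> inv u) ` {r \<in> carrier G. side (inv u \<otimes> w) r} \<subseteq> separating u w"
    proof (rule image_subsetI)
      fix r assume r: "r \<in> {r \<in> carrier G. side (inv u \<otimes> w) r}"
      then show "u \<otimes> r \<otimes> inv u \<in> separating u w"
        using separating_iff[OF assms, of "u \<otimes> r \<otimes> inv u"] ** assms by simp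
    qed
  qed
  then show ?thesis using card_side[of "inv u \<otimes> w"] assms by (simp add: bij_betw_same_card)
qed

lemma wdist_sym: "u \<in> carrier G \<Longrightarrow> w \<in> carrier G \<Longrightarrow> wdist u w = wdist w u"
  using card_separating[of u w] card_separating[of w u]
  by (simp add: separating_def eq_commute[of "side u _"])

lemma wdist_one: "w \<in> carrier G \<Longrightarrow> wdist w \<one> = len w"
  using wdist_sym[of w \<one>] by simp

lemma wdist_triangle:
  assumes "u \<in> carrier G" "v \<in> carrier G" "w \<in> carrier G"
  shows "wdist u w \<le> wdist u v + wdist v w"
proof -
  have "card (separating u w) \<le> card (separating u v \<union> separating v w)"
    by (rule card_mono) (use assms finite_separating in \<open>auto simp: separating_def\<close>)
  also have "\<dots> \<le> card (separating u v) + card (separating v w)" by (rule card_Un_le)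
  finally show ?thesis using assms by (simp add: card_separating)
qed

text \<open>Sides take two values, so \<open>separating u w\<close> is the symmetric difference of
  the other two sets. The defect of the triangle inequality thus counts, twice each, the walls
  crossed both before and after \<open>v\<close>.\<close>

lemma wdist_defect:
  assumes "u \<in> carrier G" "v \<in> carrier G" "w \<in> carrier G"
  shows "wdist u v + wdist v w = wdist u w + 2 * card (separating u v \<inter> separating v w)"
proof -
  let ?A = "separating u v" and ?B = "separating v w"
  have f: "finite ?A" "finite ?B" using assms finite_separating by auto
  have "separating u w = (?A - ?B) \<union> (?B - ?A)" by (auto simp: separating_def)
  then have "card (separating u w) = card (?A - ?B) + card (?B - ?A)"
    using f by (simp add: card_Un_disjoint Diff_Int_distrib inf_commute Int_Diff Diff_Int)
  moreover have "card ?A = card (?A - ?B) + card (?A \<inter> ?B)"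
    using f card_Diff_subset_Int[of ?A ?B] card_mono[of ?A "?A \<inter> ?B"] by simp
  moreover have "card ?B = card (?B - ?A) + card (?A \<inter> ?B)"
    using f card_Diff_subset_Int[of ?B ?A] card_mono[of ?B "?B \<inter> ?A"] by (simp add: inf_commute)
  ultimately show ?thesis using assms by (simp add: card_separating)
qed

lemma finite_len_le: "finite {w \<in> carrier G. len w \<le> n}"
proof (rule finite_subset)
  show "{w \<in> carrier G. len w \<le> n} \<subseteq> word_prod G ` {ws. set ws \<subseteq> S \<and> length ws \<le> n}"
  proof
    fix w assume w: "w \<in> {w \<in> carrier G. len w \<le> n}"
    then obtain ws where "set ws \<subseteq> S" "length ws = len w" "word_prod G ws = w"
      using len_word by blast
    then show "w \<in> word_prod G ` {ws. set ws \<subseteq> S \<and> length ws \<le> n}" using w by force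
  qed
  show "finite (word_prod G ` {ws. set ws \<subseteq> S \<and> length ws \<le> n})"
    using finite_lists_length_le[OF finite_S] by simp
qed

end

subsection \<open>Geodesics and folding\<close>


lemma closed_simplex_nonneg: "p \<in> closed_simplex \<sigma> \<Longrightarrow> 0 \<le> p v"
  and closed_simplex_outside: "p \<in> closed_simplex \<sigma> \<Longrightarrow> v \<notin> \<sigma> \<Longrightarrow> p v = 0"
  and closed_simplex_sum: "p \<in> closed_simplex \<sigma> \<Longrightarrow> (\<Sum>v\<in>\<sigma>. p v) = 1"
  by (simp_all add: closed_simplex_def)

lemma vertex_point_closed_simplex:
  assumes "finite \<sigma>" "v \<in> \<sigma>"
  shows "vertex_point v \<in> closed_simplex \<sigma>"
  using assms by (auto simp: closed_simplex_def vertex_point_def sum.delta)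

section \<open>Betweenness in CAT(0) spaces\<close>

lemma CAT0_geodesic:
  assumes "CAT0 X d" "a \<in> X" "b \<in> X"
  obtains g where "geodesic_from_to X d g a b"
proof -
  have "\<forall>a\<in>X. \<forall>b\<in>X. \<exists>g. geodesic_from_to X d g a b"
    using assms(1) unfolding CAT0_def by (elim conjE)
  then show ?thesis using that assms by blast
qed

text \<open>The comparison triangle of \<open>a\<close>, \<open>x\<close>, \<open>c\<close> is
  degenerate, so \<open>x\<close> and the point of \<open>h\<close> at the same distance from
  \<open>c\<close> have the same comparison point, and the CAT(0) inequality puts them at distance
  0. The orientation of \<open>h\<close> is that of the third side of the triangle.\<close>

lemma CAT0_between:
  assumes cat: "CAT0 X d" and X: "a \<in> X" "x \<in> X" "c \<in> X"
    and h: "geodesic_from_to X d h c a" and btw: "d a x + d x c = d a c"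
  shows "h (d x c) = x"
proof -
  have m: "\<And>x y. x \<in> X \<Longrightarrow> y \<in> X \<Longrightarrow> 0 \<le> d x y \<and> (d x y = 0 \<longleftrightarrow> x = y) \<and> d x y = d y x"
    using cat unfolding CAT0_def is_metric_on_def by blast
  obtain g1 g2 where g: "geodesic_from_to X d g1 a x" "geodesic_from_to X d g2 x c"
    using CAT0_geodesic[OF cat] X by metis
  \<comment> \<open>The comparison triangle is placed on the real axis with \<open>a\<close> at 0;
    its sides fit because of \<open>btw\<close>.\<close>
  define y' z' :: complex where "y' = complex_of_real (d a x)" and "z' = complex_of_real (d a c)"
  have zy: "z' - y' = complex_of_real (d x c)" unfolding y'_def z'_def using btw by (simp flip: of_real_diff)
  have norms: "cmod (0 - y') = d a x" "cmod (y' - z') = d x c" "cmod (z' - 0) = d c a"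
    using X m[of a x] m[of x c] m[of a c] zy norm_minus_commute[of y' z']
    by (auto simp: y'_def z'_def simp del: of_real_diff)
  let ?P = "side_pairs d g1 a x 0 y' \<union> side_pairs d g2 x c y' z' \<union> side_pairs d h c a z' 0"
  have "\<forall>x\<in>X. \<forall>y\<in>X. \<forall>z\<in>X. \<forall>g1 g2 g3 x' y' z'.
        geodesic_from_to X d g1 x y \<and> geodesic_from_to X d g2 y z \<and> geodesic_from_to X d g3 z x \<and>
        cmod (x' - y') = d x y \<and> cmod (y' - z') = d y z \<and> cmod (z' - x') = d z x \<longrightarrow>
        (let P = side_pairs d g1 x y x' y' \<union> side_pairs d g2 y z y' z' \<union> side_pairs d g3 z x z' x'
         in \<forall>(p, p') \<in> P. \<forall>(q, q') \<in> P. d p q \<le> cmod (p' - q'))"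
    using cat unfolding CAT0_def by (elim conjE)
  note this[THEN bspec, OF X(1), THEN bspec, OF X(2), THEN bspec, OF X(3),
      THEN spec[where x = g1], THEN spec[where x = g2], THEN spec[where x = h],
      THEN spec[where x = 0], THEN spec[where x = y'], THEN spec[where x = z']]
  then have all: "\<forall>(p, p') \<in> ?P. \<forall>(q, q') \<in> ?P. d p q \<le> cmod (p' - q')"
    using g h norms unfolding Let_def by blast
  have 1: "(x, y') \<in> ?P"
  proof -
    have "(x, y') = (g1 (d a x), 0 + complex_of_real (d a x / d a x) * (y' - 0))"
      using g(1) by (simp add: geodesic_from_to_def y'_def)
    then show ?thesis using m[of a x] X unfolding side_pairs_def by fastforce
  qed
  have dx: "d x c \<in> {0..d c a}" using btw m[of a x] m[of x c] m[of a c] X by auto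
  have 2: "(h (d x c), y') \<in> ?P"
  proof -
    have "y' = z' + complex_of_real (d x c / d c a) * (0 - z')"
    \<comment> \<open>For \<open>d c a = 0\<close> the quotient has the default value 0, which is
      right since \<open>y'\<close> and \<open>z'\<close> are then both 0.\<close>
    proof (cases "d c a = 0")
      case True
      then show ?thesis using dx zy by (simp add: z'_def)
    next
      case False
      then have "complex_of_real (d x c / d c a) * z' = complex_of_real (d x c)"
        using m[of a c] X by (simp add: z'_def)
      then have "complex_of_real (d x c / d c a) * (0 - z') = - complex_of_real (d x c)"
        by (simp only: diff_0 mult_minus_right)
      moreover have "y' = z' - complex_of_real (d x c)" unfolding zy[symmetric] by simp
      ultimately show ?thesis by simp
    qed
    then show ?thesis using dx unfolding side_pairs_def by blast
  qed
  have "h (d x c) \<in> X" using h dx by (simp add: geodesic_from_to_def)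
  moreover have "d (h (d x c)) x \<le> cmod (y' - y')"
    using all[THEN bspec, OF 2] 1 by fast
  ultimately show ?thesis using m[of "h (d x c)" x] X by force
qed

lemma CAT0_between_unique:
  assumes "CAT0 X d" "a \<in> X" "x \<in> X" "y \<in> X" "c \<in> X"
    and "d a x + d x c = d a c" "d a y + d y c = d a c" "d x c = d y c"
  shows "x = y"
proof -
  obtain h where "geodesic_from_to X d h c a" using CAT0_geodesic assms by metis
  then show ?thesis using CAT0_between assms by metis
qed

section \<open>The action on the Davis complex\<close>

context coxeter
begin

abbreviation coset_translate :: "'w \<Rightarrow> 'w set \<Rightarrow> 'w set" (infixr "\<cdot>" 75) where
  "w \<cdot> v \<equiv> w <#\<^bsub>G\<^esub> v"

lemma generate_subgroup: "T \<subseteq> S \<Longrightarrow> subgroup (generate G T) G"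
  using S_carrier by (intro generate_is_subgroup) auto

lemma davis_vertex_carrier: "v \<in> davis_vertices G S \<Longrightarrow> v \<subseteq> carrier G"
  using l_coset_subset_G[OF subgroup.subset[OF generate_subgroup]]
  by (auto simp: davis_vertices_def spherical_def)

lemma davis_vertex_coset:
  assumes "v \<in> davis_vertices G S" "u \<in> v"
  obtains T where "spherical G S T" "v = u \<cdot> generate G T"
proof -
  obtain w T where "v = w \<cdot> generate G T" "w \<in> carrier G" "spherical G S T"
    using assms by (auto simp: davis_vertices_def)
  then show ?thesis
    using that assms l_repr_independence[of u w "generate G T"] generate_subgroup
    by (auto simp: spherical_def)
qed

lemma davis_vertex_nonempty: "v \<in> davis_vertices G S \<Longrightarrow> v \<noteq> {}"
  using generate.one[of G] by (auto simp: davis_vertices_def l_coset_def)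

lemma davis_vertex_translate:
  assumes "w \<in> carrier G" "v \<in> davis_vertices G S"
  shows "w \<cdot> v \<in> davis_vertices G S"
proof -
  obtain u T where u: "v = u \<cdot> generate G T" "u \<in> carrier G" "spherical G S T"
    using assms by (auto simp: davis_vertices_def)
  then have "w \<cdot> v = (w \<otimes> u) \<cdot> generate G T"
    using assms lcos_m_assoc[OF subgroup.subset[OF generate_subgroup]] by (simp add: spherical_def)
  then show ?thesis using assms u unfolding davis_vertices_def by blast
qed

lemma coset_cancel:
  assumes "w \<in> carrier G" "v \<subseteq> carrier G"
  shows "inv w \<cdot> (w \<cdot> v) = v" "w \<cdot> (inv w \<cdot> v) = v"
  using assms by (simp_all add: lcos_m_assoc lcos_mult_one)

lemma translate_subset_carrier: "w \<in> carrier G \<Longrightarrow> v \<subseteq> carrier G \<Longrightarrow> w \<cdot> v \<subseteq> carrier G"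
  by (rule l_coset_subset_G)

lemma davis_simplexD:
  assumes "\<sigma> \<in> davis_simplices G S"
  shows "\<sigma> \<noteq> {}" "finite \<sigma>" "\<sigma> \<subseteq> davis_vertices G S"
    "\<And>v. v \<in> \<sigma> \<Longrightarrow> v \<in> davis_vertices G S" "\<And>v. v \<in> \<sigma> \<Longrightarrow> v \<subseteq> carrier G"
  using assms davis_vertex_carrier by (auto simp: davis_simplices_def)

lemma davis_simplex_translate:
  assumes "w \<in> carrier G" "\<sigma> \<in> davis_simplices G S"
  shows "(\<cdot>) w ` \<sigma> \<in> davis_simplices G S"
proof -
  have mono: "w \<cdot> u \<subseteq> w \<cdot> v" if "u \<subseteq> v" for u v using that by (auto simp: l_coset_def)
  have "w \<cdot> u \<subseteq> w \<cdot> v \<or> w \<cdot> v \<subseteq> w \<cdot> u" if "u \<in> \<sigma>" "v \<in> \<sigma>" for u v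
    using mono[of u v] mono[of v u] assms(2) that by (auto simp: davis_simplices_def)
  then show ?thesis
    using assms davis_vertex_translate[OF assms(1)] by (auto simp: davis_simplices_def)
qed

text \<open>The vertices form a finite chain under inclusion, so the elements of the smallest one
  lie in all of them.\<close>

lemma davis_simplex_chamber:
  assumes "\<sigma> \<in> davis_simplices G S"
  obtains w where "w \<in> carrier G" "w \<in> \<Inter>\<sigma>"
proof -
  note s = davis_simplexD[OF assms]
  obtain m where m: "m \<in> \<sigma>" "\<forall>v\<in>\<sigma>. v \<subseteq> m \<longrightarrow> m = v"
    using finite_has_minimal[OF s(2,1)] by blast
  have "\<forall>u\<in>\<sigma>. \<forall>v\<in>\<sigma>. u \<subseteq> v \<or> v \<subseteq> u" using assms by (simp add: davis_simplices_def)
  then have "m \<subseteq> v" if "v \<in> \<sigma>" for v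
    using m(1) m(2)[THEN bspec, OF that] that by (metis order_refl)
  moreover obtain w where "w \<in> m" using davis_vertex_nonempty[OF s(4)[OF m(1)]] by blast
  ultimately show ?thesis using that[of w] s(5)[OF m(1)] by blast
qed

lemma davis_points_chamber:
  assumes "p \<in> davis_points G S"
  obtains w where "w \<in> carrier G" "p \<in> chamber_points G S w"
proof -
  obtain \<sigma> where s: "\<sigma> \<in> davis_simplices G S" "p \<in> closed_simplex \<sigma>"
    using assms by (auto simp: davis_points_def)
  obtain w where "w \<in> carrier G" "w \<in> \<Inter>\<sigma>" using davis_simplex_chamber[OF s(1)] .
  then show ?thesis using that[of w] s by (auto simp: chamber_points_def)
qed

lemma chamber_points_subset: "chamber_points G S w \<subseteq> davis_points G S"
  by (auto simp: chamber_points_def davis_points_def)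

lemma davis_singleton: "v \<in> davis_vertices G S \<Longrightarrow> {v} \<in> davis_simplices G S"
  by (auto simp: davis_simplices_def)

lemma vertex_point_chamber:
  assumes "v \<in> davis_vertices G S" "w \<in> v"
  shows "vertex_point v \<in> chamber_points G S w"
  using assms davis_singleton[OF assms(1)] vertex_point_closed_simplex[of "{v}" v]
  unfolding chamber_points_def by blast

lemma generate_vertex: "spherical G S T \<Longrightarrow> generate G T \<in> davis_vertices G S"
  using lcos_mult_one[OF subgroup.subset[OF generate_subgroup], of T]
  unfolding davis_vertices_def spherical_def by (intro CollectI exI[of _ \<one>] exI[of _ T]) simp

lemma cone_vertex_vertex: "cone_vertex G \<in> davis_vertices G S"
  using generate_vertex[of "{}"] by (simp add: spherical_def cone_vertex_def generate_empty)

lemma cone_vertex_chamber: "vertex_point (cone_vertex G) \<in> chamber_points G S \<one>"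
  using vertex_point_chamber[OF cone_vertex_vertex] by (simp add: cone_vertex_def)

text \<open>The guard makes the action of \<open>G\<close> on points well behaved on sets of elements that are not
  contained in the carrier, where multiplication is unspecified.\<close>
definition act :: "'w \<Rightarrow> 'w point \<Rightarrow> 'w point" where
  "act w p = (\<lambda>v. if v \<subseteq> carrier G then p (inv w \<cdot> v) else 0)"

lemma act_translate: "w \<in> carrier G \<Longrightarrow> v \<subseteq> carrier G \<Longrightarrow> act w p (w \<cdot> v) = p v"
  by (simp add: act_def translate_subset_carrier coset_cancel)

lemma inj_on_translate: "w \<in> carrier G \<Longrightarrow> \<sigma> \<in> davis_simplices G S \<Longrightarrow> inj_on ((\<cdot>) w) \<sigma>"
  using davis_simplexD(5) by (intro inj_on_inverseI[where g = "(\<cdot>) (inv w)"]) (auto simp: coset_cancel)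

lemma act_closed_simplex:
  assumes "w \<in> carrier G" "\<sigma> \<in> davis_simplices G S" "p \<in> closed_simplex \<sigma>"
  shows "act w p \<in> closed_simplex ((\<cdot>) w ` \<sigma>)"
  unfolding closed_simplex_def
proof (intro CollectI conjI allI impI)
  show "0 \<le> act w p v" for v using closed_simplex_nonneg[OF assms(3)] by (simp add: act_def)
  show "act w p v = 0" if "v \<notin> (\<cdot>) w ` \<sigma>" for v
  proof (cases "v \<subseteq> carrier G")
    case True
    then have "v = w \<cdot> (inv w \<cdot> v)" using assms coset_cancel by simp
    then have "inv w \<cdot> v \<notin> \<sigma>" using that by blast
    then show ?thesis using closed_simplex_outside[OF assms(3)] by (simp add: act_def)
  qed (simp add: act_def)
  have "(\<Sum>v\<in>(\<cdot>) w ` \<sigma>. act w p v) = (\<Sum>v\<in>\<sigma>. act w p (w \<cdot> v))"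
    using inj_on_translate assms by (simp add: sum.reindex)
  also have "\<dots> = (\<Sum>v\<in>\<sigma>. p v)"
    using assms davis_simplexD(5) act_translate by (intro sum.cong) auto
  finally show "(\<Sum>v\<in>(\<cdot>) w ` \<sigma>. act w p v) = 1" using closed_simplex_sum[OF assms(3)] by simp
qed

lemma act_chamber:
  assumes "w \<in> carrier G" "p \<in> chamber_points G S u"
  shows "act w p \<in> chamber_points G S (w \<otimes> u)"
proof -
  obtain \<sigma> where s: "\<sigma> \<in> davis_simplices G S" "u \<in> \<Inter>\<sigma>" "p \<in> closed_simplex \<sigma>"
    using assms by (auto simp: chamber_points_def)
  then have "w \<otimes> u \<in> \<Inter>((\<cdot>) w ` \<sigma>)" by (auto simp: l_coset_def)
  then show ?thesis
    using act_closed_simplex[OF assms(1) s(1,3)] davis_simplex_translate[OF assms(1) s(1)]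
    unfolding chamber_points_def by blast
qed

lemma act_points:
  assumes "w \<in> carrier G" "p \<in> davis_points G S"
  shows "act w p \<in> davis_points G S"
proof -
  obtain u where "u \<in> carrier G" "p \<in> chamber_points G S u" using assms davis_points_chamber by blast
  then show ?thesis using act_chamber[OF assms(1)] chamber_points_subset by blast
qed

lemma act_vertex_point:
  assumes "w \<in> carrier G" "v \<subseteq> carrier G"
  shows "act w (vertex_point v) = vertex_point (w \<cdot> v)"
proof
  fix u
  have "inv w \<cdot> u = v \<longleftrightarrow> u = w \<cdot> v" if "u \<subseteq> carrier G"
    using coset_cancel assms that by metis
  then show "act w (vertex_point v) u = vertex_point (w \<cdot> v) u"
    using translate_subset_carrier[OF assms] by (auto simp: act_def vertex_point_def)
qed

text \<open>A vertex at which \<open>p\<close> is nonzero is a coset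
  \<open>u \<cdot> generate G T\<close> containing \<open>u\<close> and \<open>u'\<close>. Hence
  \<open>inv u \<otimes> u'\<close> lies in \<open>generate G T\<close>, so does
  \<open>inv u \<otimes> r \<otimes> u\<close> as one of its inversions, and \<open>r\<close> maps
  the coset to itself.\<close>

lemma act_wall_fixed:
  assumes u: "u \<in> carrier G" "p \<in> chamber_points G S u"
    and u': "u' \<in> carrier G" "p \<in> chamber_points G S u'"
    and r: "r \<in> separating u u'"
  shows "act r p = p"
proof -
  have rc: "r \<in> carrier G" using r by (simp add: separating_def)
  obtain \<sigma> where s: "\<sigma> \<in> davis_simplices G S" "u \<in> \<Inter>\<sigma>" "p \<in> closed_simplex \<sigma>"
    using u by (auto simp: chamber_points_def)
  obtain \<sigma>' where s': "\<sigma>' \<in> davis_simplices G S" "u' \<in> \<Inter>\<sigma>'" "p \<in> closed_simplex \<sigma>'"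
    using u' by (auto simp: chamber_points_def)
  have supp: "v \<in> davis_vertices G S \<and> v \<subseteq> carrier G \<and> r \<cdot> v = v" if "p v \<noteq> 0" for v
  proof -
    have v: "v \<in> \<sigma>" "v \<in> \<sigma>'" using that closed_simplex_outside s s' by metis+
    then have vv: "v \<in> davis_vertices G S" "u \<in> v" "u' \<in> v" using s s' davis_simplexD by blast+
    obtain T where T: "spherical G S T" "v = u \<cdot> generate G T"
      using davis_vertex_coset vv by metis
    have TS: "T \<subseteq> S" using T by (simp add: spherical_def)
    note sub = generate_subgroup[OF TS] and subc = subgroup.subset[OF generate_subgroup[OF TS]]
    obtain h where h: "h \<in> generate G T" "u' = u \<otimes> h" using vv T by (auto simp: l_coset_def)
    then have "inv u \<otimes> u' \<in> generate G T" using u subc by (auto simp: m_assoc[symmetric])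
    moreover have "side (inv u \<otimes> u') (inv u \<otimes> r \<otimes> u)"
      using separating_iff[OF u(1) u'(1) rc] r by simp
    ultimately have "inv u \<otimes> r \<otimes> u \<in> generate G T"
      using side_generate[OF TS] u rc by simp
    moreover have "r \<otimes> u = u \<otimes> (inv u \<otimes> r \<otimes> u)" using u rc by (simp add: m_assoc[symmetric])
    ultimately have "r \<otimes> u \<in> u \<cdot> generate G T" unfolding l_coset_def by blast
    then have "(r \<otimes> u) \<cdot> generate G T = u \<cdot> generate G T"
      using l_repr_independence[OF _ u(1) sub] by simp
    then show ?thesis using T vv davis_vertex_carrier u rc subc by (simp add: lcos_m_assoc)
  qed
  show ?thesis
  proof
    fix v
    show "act r p v = p v"
    proof (cases "v \<subseteq> carrier G")
      case True
      show ?thesis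
      \<comment> \<open>If one of the two coordinates is nonzero, its vertex is fixed by
        \<open>r\<close>, which forces \<open>inv r \<cdot> v = v\<close>.\<close>
      proof (cases "p v = 0 \<and> p (inv r \<cdot> v) = 0")
        case False
        then have "r \<cdot> v = v \<or> r \<cdot> (inv r \<cdot> v) = inv r \<cdot> v" using supp by blast
        then have "inv r \<cdot> v = v" using coset_cancel[OF rc True] by auto
        then show ?thesis using True by (simp add: act_def)
      qed (simp add: act_def)
    next
      case False
      then show ?thesis using supp by (auto simp: act_def)
    qed
  qed
qed

end

section \<open>Strings and the length metric\<close>

locale davis_complex = coxeter G S for G :: "'w monoid" (structure) and S +
  fixes l :: "'w set \<Rightarrow> 'w set \<Rightarrow> real"
  assumes pe: "pe_edge_lengths G S l" and invariant: "W_invariant_lengths G S l"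
    and cat0: "CAT0 (davis_points G S) (pe_dist G S l)"
    and balls: "balls_meet_boundedly_many_chambers G S (pe_dist G S l)"
begin

abbreviation dist_l :: "'w point \<Rightarrow> 'w point \<Rightarrow> real" where "dist_l \<equiv> pe_dist G S l"

lemma dist_l_metric: "is_metric_on (davis_points G S) dist_l"
  using cat0 unfolding CAT0_def by (elim conjE)

lemma dist_l_nonneg: "p \<in> davis_points G S \<Longrightarrow> q \<in> davis_points G S \<Longrightarrow> 0 \<le> dist_l p q"
  and dist_l_zero: "p \<in> davis_points G S \<Longrightarrow> q \<in> davis_points G S \<Longrightarrow> dist_l p q = 0 \<longleftrightarrow> p = q"
  and dist_l_triangle: "p \<in> davis_points G S \<Longrightarrow> q \<in> davis_points G S \<Longrightarrow> x \<in> davis_points G S \<Longrightarrow>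
    dist_l p x \<le> dist_l p q + dist_l q x"
  using dist_l_metric by (simp_all add: is_metric_on_def)

lemma geodesic_exists:
  assumes "p \<in> davis_points G S" "q \<in> davis_points G S"
  obtains g where "geodesic_from_to (davis_points G S) dist_l g p q"
  using CAT0_geodesic[OF cat0] assms that by blast

text \<open>The expression under the root is the squared norm of the vector with coordinates
  \<open>\<Sum>v\<in>\<sigma>. a v * x v i\<close>. This must be checked because \<open>sqrt\<close>
  is negative at negative numbers and the infimum of string lengths needs a lower bound.\<close>

lemma simplex_dist_nonneg:
  assumes "\<sigma> \<in> davis_simplices G S" "p \<in> closed_simplex \<sigma>" "q \<in> closed_simplex \<sigma>"
  shows "0 \<le> simplex_dist l \<sigma> p q"
proof -
  obtain N :: nat and x :: "'w set \<Rightarrow> nat \<Rightarrow> real" where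
    "\<forall>v\<in>\<sigma>. \<forall>u\<in>\<sigma>. l v u = sqrt (\<Sum>i<N. (x v i - x u i)\<^sup>2)"
    using pe[unfolded pe_edge_lengths_def, THEN bspec, OF assms(1)]
    by (elim exE conjE) (rule that)
  then have lx: "l v u = sqrt (\<Sum>i<N. (x v i - x u i)\<^sup>2)" if "v \<in> \<sigma>" "u \<in> \<sigma>" for v u
    using that by simp
  define a where "a v = p v - q v" for v
  have a0: "(\<Sum>v\<in>\<sigma>. a v) = 0"
    using closed_simplex_sum[OF assms(2)] closed_simplex_sum[OF assms(3)]
    by (simp add: a_def sum_subtractf)
  have "(\<Sum>v\<in>\<sigma>. \<Sum>u\<in>\<sigma>. a v * a u * (l v u)\<^sup>2) = (\<Sum>v\<in>\<sigma>. \<Sum>u\<in>\<sigma>. \<Sum>i<N. a v * a u * (x v i - x u i)\<^sup>2)"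
    by (intro sum.cong refl) (simp add: lx sum_nonneg sum_distrib_left)
  also have "\<dots> = (\<Sum>v\<in>\<sigma>. \<Sum>i<N. \<Sum>u\<in>\<sigma>. a v * a u * (x v i - x u i)\<^sup>2)"
    by (rule sum.cong[OF refl], rule sum.swap)
  also have "\<dots> = (\<Sum>i<N. \<Sum>v\<in>\<sigma>. \<Sum>u\<in>\<sigma>. a v * a u * (x v i - x u i)\<^sup>2)"
    by (rule sum.swap)
  also have "\<dots> = - 2 * (\<Sum>i<N. (\<Sum>v\<in>\<sigma>. a v * x v i)\<^sup>2)"
    unfolding sum_distrib_left
  proof (rule sum.cong[OF refl])
    fix i
    \<comment> \<open>After expanding the square, both pure terms carry the factor
      \<open>\<Sum>v\<in>\<sigma>. a v\<close>, which is 0; the mixed term remains.\<close>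
    have "(\<Sum>v\<in>\<sigma>. \<Sum>u\<in>\<sigma>. a v * a u * (x v i - x u i)\<^sup>2) =
      (\<Sum>v\<in>\<sigma>. \<Sum>u\<in>\<sigma>. (a v * (x v i)\<^sup>2) * a u + a v * (a u * (x u i)\<^sup>2) - 2 * ((a v * x v i) * (a u * x u i)))"
      by (intro sum.cong refl) (simp add: power2_eq_square algebra_simps)
    also have "\<dots> = (\<Sum>v\<in>\<sigma>. a v * (x v i)\<^sup>2) * (\<Sum>u\<in>\<sigma>. a u) + (\<Sum>v\<in>\<sigma>. a v) * (\<Sum>u\<in>\<sigma>. a u * (x u i)\<^sup>2)
       - 2 * ((\<Sum>v\<in>\<sigma>. a v * x v i) * (\<Sum>u\<in>\<sigma>. a u * x u i))"
      unfolding sum_product sum.distrib sum_subtractf by (simp only: sum_distrib_left)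
    finally show "(\<Sum>v\<in>\<sigma>. \<Sum>u\<in>\<sigma>. a v * a u * (x v i - x u i)\<^sup>2) = - 2 * (\<Sum>v\<in>\<sigma>. a v * x v i)\<^sup>2"
      by (simp add: a0 power2_eq_square)
  qed
  finally have "- (1/2) * (\<Sum>v\<in>\<sigma>. \<Sum>u\<in>\<sigma>. a v * a u * (l v u)\<^sup>2) = (\<Sum>i<N. (\<Sum>v\<in>\<sigma>. a v * x v i)\<^sup>2)"
    by simp
  then show ?thesis unfolding simplex_dist_def a_def by (simp add: sum_nonneg)
qed

text \<open>The strings of \<open>pe_dist\<close> without lists and indices, so that concatenating
  them and mapping them simplex by simplex become inductions.\<close>

inductive pe_string :: "'w point \<Rightarrow> 'w point \<Rightarrow> real \<Rightarrow> bool" where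
  string_refl: "pe_string p p 0"
| string_step: "pe_string p q L \<Longrightarrow> \<sigma> \<in> davis_simplices G S \<Longrightarrow> q \<in> closed_simplex \<sigma> \<Longrightarrow> x \<in> closed_simplex \<sigma> \<Longrightarrow>
    pe_string p x (L + simplex_dist l \<sigma> q x)"

lemma pe_dist_string: "dist_l p q = Inf {L. pe_string p q L}"
proof -
  let ?ok = "\<lambda>n xs \<sigma>s. length xs = Suc n \<and> length \<sigma>s = n \<and>
       (\<forall>i<n. \<sigma>s ! i \<in> davis_simplices G S \<and> xs ! i \<in> closed_simplex (\<sigma>s ! i) \<and>
              xs ! Suc i \<in> closed_simplex (\<sigma>s ! i))"
  let ?len = "\<lambda>n xs \<sigma>s. \<Sum>i<n. simplex_dist l (\<sigma>s ! i) (xs ! i) (xs ! Suc i)"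
  have 1: "pe_string (xs ! 0) (xs ! n) (?len n xs \<sigma>s)" if "?ok n xs \<sigma>s" for n xs \<sigma>s
  proof -
    have "pe_string (xs ! 0) (xs ! k) (?len k xs \<sigma>s)" if "k \<le> n" for k
      using that
    proof (induction k)
      case 0
      then show ?case by (simp add: string_refl)
    next
      case (Suc k)
      then show ?case using string_step[of "xs ! 0" "xs ! k" _ "\<sigma>s ! k" "xs ! Suc k"] \<open>?ok n xs \<sigma>s\<close> by simp
    qed
    then show ?thesis by simp
  qed
  have 2: "\<exists>n xs \<sigma>s. L = ?len n xs \<sigma>s \<and> xs ! 0 = p \<and> xs ! n = q \<and> ?ok n xs \<sigma>s"
    if "pe_string p q L" for p q L
    using that
  proof (induction rule: pe_string.induct)
    case (string_refl p)
    show ?case by (intro exI[of _ 0] exI[of _ "[p]"] exI[of _ "[]"]) simp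
  next
    case (string_step p q L \<sigma> x)
    from string_step.IH obtain n xs \<sigma>s where *: "L = ?len n xs \<sigma>s" "xs ! 0 = p" "xs ! n = q" "?ok n xs \<sigma>s"
      by blast
    have "?len n (xs @ [x]) (\<sigma>s @ [\<sigma>]) = ?len n xs \<sigma>s"
      using * by (intro sum.cong) (auto simp: nth_append)
    then show ?case
      using * string_step.hyps
      by (intro exI[of _ "Suc n"] exI[of _ "xs @ [x]"] exI[of _ "\<sigma>s @ [\<sigma>]"])
         (auto simp: nth_append less_Suc_eq)
  qed
  have "{?len n xs \<sigma>s | n xs \<sigma>s. length xs = Suc n \<and> length \<sigma>s = n \<and> xs ! 0 = p \<and> xs ! n = q \<and>
       (\<forall>i<n. \<sigma>s ! i \<in> davis_simplices G S \<and> xs ! i \<in> closed_simplex (\<sigma>s ! i) \<and>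
              xs ! Suc i \<in> closed_simplex (\<sigma>s ! i))} = {L. pe_string p q L}"
    (is "?A = ?B")
  proof
    show "?A \<subseteq> ?B" using 1 by blast
    show "?B \<subseteq> ?A" using 2[of p q] by blast
  qed
  then show ?thesis unfolding pe_dist_def by simp
qed

lemma pe_string_nonneg: "pe_string p q L \<Longrightarrow> 0 \<le> L"
  by (induction rule: pe_string.induct) (auto simp: simplex_dist_nonneg)

lemma pe_string_trans: "pe_string q x L' \<Longrightarrow> pe_string p q L \<Longrightarrow> pe_string p x (L + L')"
proof (induction arbitrary: L rule: pe_string.induct)
  case (string_step q y L' \<sigma> x)
  then have "pe_string p y (L + L')" by blast
  from pe_string.string_step[OF this string_step.hyps(2-4)] show ?case by (simp add: add.assoc)
qed simp

text \<open>If \<open>p\<close> and \<open>q\<close> were not joined by a string, then \<open>dist_l p q\<close> would be the junk value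
  \<open>Inf {}\<close>; but the midpoint of a geodesic lies at half this distance from both, so it is
  joined to both.\<close>
lemma pe_string_exists:
  assumes "p \<in> davis_points G S" "q \<in> davis_points G S"
  shows "\<exists>L. pe_string p q L"
proof (rule ccontr)
  assume no: "\<not> ?thesis"
  define c where "c = dist_l p q"
  have ce: "c = Inf {}" using no by (simp add: c_def pe_dist_string)
  have "p \<noteq> q" using no string_refl by auto
  then have c0: "c > 0" using dist_l_nonneg[OF assms] dist_l_zero[OF assms] by (simp add: c_def)
  obtain g where g: "geodesic_from_to (davis_points G S) dist_l g p q"
    using geodesic_exists assms by blast
  define m where "m = g (c / 2)"
  have half: "c / 2 \<in> {0..c}" "0 \<in> {0..c}" "c \<in> {0..c}" using c0 by auto
  have "dist_l p m = c / 2" "dist_l m q = c / 2"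
    using g half c0 unfolding geodesic_from_to_def m_def c_def[symmetric] by fastforce+
  moreover have "dist_l x y = c" if "\<not> (\<exists>L. pe_string x y L)" for x y
    using that ce by (simp add: pe_dist_string)
  ultimately have "(\<exists>L. pe_string p m L) \<and> (\<exists>L. pe_string m q L)" using c0 by force
  then show False using pe_string_trans no by blast
qed

text \<open>Such a map carries strings to strings of the same length, so the infimum for the images
  runs over a larger set. The smaller set has to be nonempty, which is why
  \<open>pe_string_exists\<close> comes first. Isometry is only asked on each simplex, so that
  foldings are covered.\<close>

lemma simplexwise_isometry_contracts:
  assumes f: "\<And>\<sigma>. \<sigma> \<in> davis_simplices G S \<Longrightarrow> \<exists>\<sigma>'\<in>davis_simplices G S.
      \<forall>p\<in>closed_simplex \<sigma>. f p \<in> closed_simplex \<sigma>' \<and>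
        (\<forall>q\<in>closed_simplex \<sigma>. simplex_dist l \<sigma>' (f p) (f q) = simplex_dist l \<sigma> p q)"
    and pq: "p \<in> davis_points G S" "q \<in> davis_points G S"
  shows "dist_l (f p) (f q) \<le> dist_l p q"
proof -
  have "pe_string (f p) (f q) L" if "pe_string p q L" for p q L
    using that
  proof (induction rule: pe_string.induct)
    case (string_step p q L \<sigma> x)
    obtain \<sigma>' where "\<sigma>' \<in> davis_simplices G S" "f q \<in> closed_simplex \<sigma>'" "f x \<in> closed_simplex \<sigma>'"
      "simplex_dist l \<sigma>' (f q) (f x) = simplex_dist l \<sigma> q x"
      using f[OF string_step.hyps(2)] string_step.hyps by blast
    then show ?case using pe_string.string_step[OF string_step.IH] by metis
  qed (rule string_refl)
  then show ?thesis
    unfolding pe_dist_string using pe_string_exists[OF pq] pe_string_nonneg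
    by (intro cInf_superset_mono) (auto intro: bdd_belowI[where m = 0])
qed

section \<open>Translations and foldings\<close>

lemma simplex_dist_act:
  assumes "w \<in> carrier G" "\<sigma> \<in> davis_simplices G S"
  shows "simplex_dist l ((\<cdot>) w ` \<sigma>) (act w p) (act w q) = simplex_dist l \<sigma> p q"
proof -
  have "(\<Sum>v\<in>(\<cdot>) w ` \<sigma>. \<Sum>u\<in>(\<cdot>) w ` \<sigma>. (act w p v - act w q v) * (act w p u - act w q u) * (l v u)\<^sup>2)
    = (\<Sum>v\<in>\<sigma>. \<Sum>u\<in>\<sigma>. (p v - q v) * (p u - q u) * (l v u)\<^sup>2)"
    unfolding sum.reindex[OF inj_on_translate[OF assms]] o_def
  proof (rule sum.cong[OF refl], rule sum.cong[OF refl])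
    fix v u assume vu: "v \<in> \<sigma>" "u \<in> \<sigma>"
    then have "l (w \<cdot> v) (w \<cdot> u) = l v u"
      using invariant assms(1) davis_simplexD(4)[OF assms(2)] by (simp add: W_invariant_lengths_def)
    then show "(act w p (w \<cdot> v) - act w q (w \<cdot> v)) * (act w p (w \<cdot> u) - act w q (w \<cdot> u)) * (l (w \<cdot> v) (w \<cdot> u))\<^sup>2
        = (p v - q v) * (p u - q u) * (l v u)\<^sup>2"
      using vu assms(1) davis_simplexD(5)[OF assms(2)] by (simp add: act_translate)
  qed
  then show ?thesis by (simp add: simplex_dist_def)
qed

lemma dist_act:
  assumes "w \<in> carrier G" "p \<in> davis_points G S" "q \<in> davis_points G S"
  shows "dist_l (act w p) (act w q) \<le> dist_l p q"
proof (rule simplexwise_isometry_contracts[OF _ assms(2,3)])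
  fix \<sigma> assume s: "\<sigma> \<in> davis_simplices G S"
  show "\<exists>\<sigma>'\<in>davis_simplices G S. \<forall>p\<in>closed_simplex \<sigma>. act w p \<in> closed_simplex \<sigma>' \<and>
        (\<forall>q\<in>closed_simplex \<sigma>. simplex_dist l \<sigma>' (act w p) (act w q) = simplex_dist l \<sigma> p q)"
    using s assms(1) by (intro bexI[of _ "(\<cdot>) w ` \<sigma>"])
      (auto simp: davis_simplex_translate act_closed_simplex simplex_dist_act)
qed

text \<open>The folding onto the half-space of \<open>r\<close> that contains the chamber of
  \<open>w\<close>. A point on the wall belongs to chambers on both sides; giving precedence to the
  near side does no harm, since \<open>r\<close> fixes such a point.\<close>

definition fold_onto :: "'w \<Rightarrow> 'w \<Rightarrow> 'w point \<Rightarrow> 'w point" where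
  "fold_onto r w p =
    (if \<exists>u\<in>carrier G. p \<in> chamber_points G S u \<and> r \<notin> separating w u then p else act r p)"

lemma fold_onto_near:
  "u \<in> carrier G \<Longrightarrow> p \<in> chamber_points G S u \<Longrightarrow> r \<notin> separating w u \<Longrightarrow> fold_onto r w p = p"
  by (auto simp: fold_onto_def)

lemma fold_onto_far:
  assumes "u \<in> carrier G" "p \<in> chamber_points G S u" "r \<in> separating w u"
  shows "fold_onto r w p = act r p"
proof (cases "\<exists>u'\<in>carrier G. p \<in> chamber_points G S u' \<and> r \<notin> separating w u'")
  case True
  then obtain u' where u': "u' \<in> carrier G" "p \<in> chamber_points G S u'" "r \<notin> separating w u'" by blast
  then have "r \<in> separating u u'" using assms by (auto simp: separating_def)
  then have "act r p = p" using act_wall_fixed assms u' by blast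
  then show ?thesis by (simp add: fold_onto_def)
next
  case False
  then show ?thesis unfolding fold_onto_def by (rule if_not_P)
qed

text \<open>Each simplex lies in a chamber, and on a chamber the folding is either the identity or
  the action of \<open>r\<close>.\<close>

lemma dist_fold_onto:
  assumes "r \<in> carrier G" "p \<in> davis_points G S" "q \<in> davis_points G S"
  shows "dist_l (fold_onto r w p) (fold_onto r w q) \<le> dist_l p q"
proof (rule simplexwise_isometry_contracts[OF _ assms(2,3)])
  fix \<sigma> assume s: "\<sigma> \<in> davis_simplices G S"
  then obtain u where u: "u \<in> carrier G" "u \<in> \<Inter>\<sigma>" using davis_simplex_chamber by blast
  have ch: "p \<in> chamber_points G S u" if "p \<in> closed_simplex \<sigma>" for p
    using that u s by (auto simp: chamber_points_def)
  show "\<exists>\<sigma>'\<in>davis_simplices G S. \<forall>p\<in>closed_simplex \<sigma>. fold_onto r w p \<in> closed_simplex \<sigma>' \<and>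
        (\<forall>q\<in>closed_simplex \<sigma>. simplex_dist l \<sigma>' (fold_onto r w p) (fold_onto r w q) = simplex_dist l \<sigma> p q)"
  proof (cases "r \<in> separating w u")
    case True
    then have "fold_onto r w p = act r p" if "p \<in> closed_simplex \<sigma>" for p
      using fold_onto_far[OF u(1) ch[OF that]] by blast
    then show ?thesis
      using s assms by (intro bexI[of _ "(\<cdot>) r ` \<sigma>"])
        (auto simp: davis_simplex_translate act_closed_simplex simplex_dist_act)
  next
    case False
    then have "fold_onto r w p = p" if "p \<in> closed_simplex \<sigma>" for p
      using fold_onto_near[OF u(1) ch[OF that]] by blast
    then show ?thesis using s by (intro bexI[of _ \<sigma>]) auto
  qed
qed

text \<open>Geodesics do not cross a wall twice: folding would turn the excursion behind the wall into
  a second geodesic.\<close>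
lemma between_wall_fixed:
  assumes ch: "wa \<in> carrier G" "a \<in> chamber_points G S wa" "wx \<in> carrier G" "x \<in> chamber_points G S wx"
      "wc \<in> carrier G" "c \<in> chamber_points G S wc"
    and btw: "dist_l a x + dist_l x c = dist_l a c"
    and r: "r \<in> separating wa wx" "r \<notin> separating wa wc"
  shows "act r x = x"
proof -
  have rc: "r \<in> carrier G" using r by (simp add: separating_def)
  have X: "a \<in> davis_points G S" "x \<in> davis_points G S" "c \<in> davis_points G S"
    using ch chamber_points_subset by blast+
  have ax: "act r x \<in> davis_points G S" using act_points rc X by blast
  have f: "fold_onto r wa a = a" "fold_onto r wa c = c" "fold_onto r wa x = act r x"
    using fold_onto_near[OF ch(1,2)] fold_onto_near[OF ch(5,6)] fold_onto_far[OF ch(3,4)] r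
    by (auto simp: separating_def)
  have "dist_l a (act r x) \<le> dist_l a x" "dist_l (act r x) c \<le> dist_l x c"
    using dist_fold_onto[OF rc X(1,2), of wa] dist_fold_onto[OF rc X(2,3), of wa] f by auto
  \<comment> \<open>By the triangle inequality both estimates are equalities, so \<open>x\<close>
    and \<open>act r x\<close> lie between \<open>a\<close> and \<open>c\<close> at the same
    distance from \<open>c\<close>.\<close>
  then show ?thesis
    using dist_l_triangle[OF X(1) ax X(3)] btw
      CAT0_between_unique[OF cat0 X(1) ax X(2,3)] by simp
qed

text \<open>The excess is twice the number of walls separating \<open>wx\<close> from both
  \<open>wa\<close> and \<open>wc\<close>. These do not separate \<open>wa\<close> from
  \<open>wc\<close>, hence fix \<open>x\<close>, and \<open>r \<otimes> wx\<close> runs through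
  distinct chambers containing \<open>x\<close>. Radius 1 merely serves to bound the number of
  those.\<close>

lemma wdist_between_bounded:
  obtains C where "\<And>wa a wx x wc c.
    \<lbrakk>wa \<in> carrier G; a \<in> chamber_points G S wa; wx \<in> carrier G; x \<in> chamber_points G S wx;
     wc \<in> carrier G; c \<in> chamber_points G S wc; dist_l a x + dist_l x c = dist_l a c\<rbrakk> \<Longrightarrow>
    wdist wa wx + wdist wx wc \<le> wdist wa wc + C"
proof -
  let ?B = "\<lambda>p. {w \<in> carrier G. \<exists>x \<in> chamber_points G S w. dist_l p x < 1}"
  obtain N where N: "\<And>p. p \<in> davis_points G S \<Longrightarrow> finite (?B p) \<and> card (?B p) \<le> N"
    using balls[unfolded balls_meet_boundedly_many_chambers_def, THEN spec, of 1] by (elim exE) (rule that, blast)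
  show ?thesis
  proof (rule that[of "2 * N"])
    fix wa a wx x wc c
    assume ch: "wa \<in> carrier G" "a \<in> chamber_points G S wa" "wx \<in> carrier G" "x \<in> chamber_points G S wx"
      "wc \<in> carrier G" "c \<in> chamber_points G S wc" and btw: "dist_l a x + dist_l x c = dist_l a c"
    have X: "x \<in> davis_points G S" using ch chamber_points_subset by blast
    let ?R = "separating wa wx \<inter> separating wx wc"
    have rc: "r \<in> carrier G" if "r \<in> ?R" for r using that by (auto simp: separating_def)
    have "(\<lambda>r. r \<otimes> wx) ` ?R \<subseteq> ?B x"
    proof (rule image_subsetI)
      fix r assume r: "r \<in> ?R"
      have "act r x = x"
        using r by (intro between_wall_fixed[OF ch btw]) (auto simp: separating_def)
      then have "x \<in> chamber_points G S (r \<otimes> wx)" using act_chamber[OF rc[OF r] ch(4)] by simp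
      moreover have "dist_l x x < 1" using dist_l_zero[OF X X] by simp
      ultimately show "r \<otimes> wx \<in> ?B x" using rc[OF r] ch by blast
    qed
    moreover have "inj_on (\<lambda>r. r \<otimes> wx) ?R" using ch rc by (auto intro!: inj_onI)
    ultimately have "card ?R \<le> N"
      using N[OF X] card_inj_on_le[of "\<lambda>r. r \<otimes> wx" ?R "?B x"] by simp
    then show "wdist wa wx + wdist wx wc \<le> wdist wa wc + 2 * N"
      using wdist_defect ch by simp
  qed
qed

text \<open>Up to translation there are only finitely many vertices.\<close>
lemma wdist_ball_bounded:
  obtains C where "\<And>v w x u. \<lbrakk>v \<in> davis_vertices G S; w \<in> v; u \<in> carrier G; x \<in> chamber_points G S u;
    dist_l (vertex_point v) x \<le> R\<rbrakk> \<Longrightarrow> wdist w u \<le> C"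
proof -
  let ?B = "\<lambda>T. {w \<in> carrier G. \<exists>x \<in> chamber_points G S w. dist_l (vertex_point (generate G T)) x < R + 1}"
  let ?U = "\<Union>T\<in>{T. spherical G S T}. ?B T"
  have "finite {T. spherical G S T}"
    by (rule finite_subset[of _ "Pow S"]) (auto simp: spherical_def finite_S)
  moreover have "finite (?B T)" if "spherical G S T" for T
  proof -
    have "vertex_point (generate G T) \<in> davis_points G S"
      using generate_vertex[OF that] vertex_point_chamber[OF _ generate.one] chamber_points_subset by blast
    then show ?thesis
      using balls[unfolded balls_meet_boundedly_many_chambers_def, THEN spec, of "R + 1"] by blast
  qed
  ultimately have "finite (len ` ?U)" by blast
  then obtain C where C: "\<And>u. u \<in> ?U \<Longrightarrow> len u \<le> C"
    by (meson finite_nat_set_iff_bounded_le imageI)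
  show ?thesis
  proof (rule that[of C])
    fix v w x u
    assume v: "v \<in> davis_vertices G S" "w \<in> v" and u: "u \<in> carrier G" "x \<in> chamber_points G S u"
      and d: "dist_l (vertex_point v) x \<le> R"
    have vc: "v \<subseteq> carrier G" "w \<in> carrier G" using davis_vertex_carrier v by auto
    obtain T where T: "spherical G S T" "v = w \<cdot> generate G T" using davis_vertex_coset v by metis
    have "generate G T \<subseteq> carrier G" using generate_subgroup T subgroup.subset by (auto simp: spherical_def)
    then have "act (inv w) (vertex_point v) = vertex_point (generate G T)"
      using vc by (simp add: act_vertex_point) (simp add: T coset_cancel)
    then have "dist_l (vertex_point (generate G T)) (act (inv w) x) \<le> R"
      using dist_act[of "inv w" "vertex_point v" x] d vc u vertex_point_chamber[OF v]
        chamber_points_subset by fastforce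
    moreover have "act (inv w) x \<in> chamber_points G S (inv w \<otimes> u)" using act_chamber u vc by simp
    ultimately have "inv w \<otimes> u \<in> ?B T" using u vc by force
    then show "wdist w u \<le> C" using C T by blast
  qed
qed

section \<open>Simplices along a geodesic\<close>

definition rep :: "'w set set \<Rightarrow> 'w" where
  "rep \<sigma> = (SOME w. w \<in> carrier G \<and> w \<in> \<Inter>\<sigma> \<and> len w = simplex_length G S \<sigma>)"

lemma rep:
  assumes "\<sigma> \<in> davis_simplices G S"
  shows "rep \<sigma> \<in> carrier G" "rep \<sigma> \<in> \<Inter>\<sigma>" "len (rep \<sigma>) = simplex_length G S \<sigma>"
proof -
  have "\<exists>n. \<exists>w\<in>carrier G. w \<in> \<Inter>\<sigma> \<and> len w = n" using davis_simplex_chamber assms by metis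
  from LeastI_ex[OF this] have "\<exists>w. w \<in> carrier G \<and> w \<in> \<Inter>\<sigma> \<and> len w = simplex_length G S \<sigma>"
    unfolding simplex_length_def by blast
  from someI_ex[OF this]
  show "rep \<sigma> \<in> carrier G" "rep \<sigma> \<in> \<Inter>\<sigma>" "len (rep \<sigma>) = simplex_length G S \<sigma>"
    unfolding rep_def by blast+
qed

text \<open>A simplex of the chamber \<open>wD\<close> is a set of cosets
  \<open>w \<cdot> generate G T\<close>, and there are at most 2^|S| of these, one for each subset
  \<open>T\<close> of \<open>S\<close>.\<close>

lemma card_simplices_chamber:
  shows "finite {\<sigma> \<in> davis_simplices G S. w \<in> \<Inter>\<sigma>}"
    and "card {\<sigma> \<in> davis_simplices G S. w \<in> \<Inter>\<sigma>} \<le> 2 ^ 2 ^ card S"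
proof -
  let ?V = "(\<lambda>T. w \<cdot> generate G T) ` Pow S"
  have sub: "{\<sigma> \<in> davis_simplices G S. w \<in> \<Inter>\<sigma>} \<subseteq> Pow ?V"
  proof safe
    fix \<sigma> v assume "\<sigma> \<in> davis_simplices G S" "w \<in> \<Inter>\<sigma>" "v \<in> \<sigma>"
    then have "v \<in> davis_vertices G S" "w \<in> v" using davis_simplexD by auto
    then show "v \<in> ?V" using davis_vertex_coset by (metis PowI imageI spherical_def)
  qed
  have fin: "finite ?V" using finite_S by simp
  have "card ?V \<le> 2 ^ card S" using card_image_le[of "Pow S"] finite_S by (simp add: card_Pow)
  then have "card (Pow ?V) \<le> 2 ^ 2 ^ card S" using fin by (simp add: card_Pow)
  moreover have "finite (Pow ?V)" using fin by simp
  ultimately show "finite {\<sigma> \<in> davis_simplices G S. w \<in> \<Inter>\<sigma>}"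
    "card {\<sigma> \<in> davis_simplices G S. w \<in> \<Inter>\<sigma>} \<le> 2 ^ 2 ^ card S"
    using finite_subset[OF sub] order_trans[OF card_mono[OF _ sub]] by blast+
qed

text \<open>What condition (d) says about a simplex \<tau> in the support of H(\<sigma>), detached
  from H.\<close>

definition follows :: "real \<Rightarrow> 'w set set \<Rightarrow> 'w set set \<Rightarrow> bool" where
  "follows R \<sigma> \<tau> \<longleftrightarrow> (\<forall>v\<in>\<sigma>. \<forall>\<gamma>.
     geodesic_from_to (davis_points G S) dist_l \<gamma> (vertex_point v) (vertex_point (cone_vertex G)) \<longrightarrow>
     (\<forall>p \<in> closed_simplex \<tau>. \<exists>s \<in> {0 .. dist_l (vertex_point v) (vertex_point (cone_vertex G))}.
        dist_l p (\<gamma> s) \<le> R))"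

text \<open>Both bounds apply \<open>wdist_between_bounded\<close> along one geodesic from a vertex
  of \<sigma> to b. For the first, a point near \<tau> lies between the two ends. For the second, of
  two points near \<tau> and \<tau>' the earlier one lies between the start and the later one, and
  equal gallery distances from \<sigma> leave only a bounded gap.\<close>

lemma follows_bounds:
  obtains C where
    "\<And>\<sigma> \<tau>. \<lbrakk>\<sigma> \<in> davis_simplices G S; \<tau> \<in> davis_simplices G S; follows R \<sigma> \<tau>\<rbrakk> \<Longrightarrow>
      wdist (rep \<tau>) (rep \<sigma>) + simplex_length G S \<tau> \<le> simplex_length G S \<sigma> + C"
    "\<And>\<sigma> \<tau> \<tau>'. \<lbrakk>\<sigma> \<in> davis_simplices G S; \<tau> \<in> davis_simplices G S; \<tau>' \<in> davis_simplices G S;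
      follows R \<sigma> \<tau>; follows R \<sigma> \<tau>'; wdist (rep \<tau>) (rep \<sigma>) = wdist (rep \<tau>') (rep \<sigma>)\<rbrakk> \<Longrightarrow>
      wdist (rep \<tau>) (rep \<tau>') \<le> C"
proof -
  obtain C0 where C0: "\<And>wa a wx x wc c.
    \<lbrakk>wa \<in> carrier G; a \<in> chamber_points G S wa; wx \<in> carrier G; x \<in> chamber_points G S wx;
     wc \<in> carrier G; c \<in> chamber_points G S wc; dist_l a x + dist_l x c = dist_l a c\<rbrakk> \<Longrightarrow>
    wdist wa wx + wdist wx wc \<le> wdist wa wc + C0" using wdist_between_bounded by blast
  obtain C1 where C1: "\<And>v w x u. \<lbrakk>v \<in> davis_vertices G S; w \<in> v; u \<in> carrier G; x \<in> chamber_points G S u;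
    dist_l (vertex_point v) x \<le> R\<rbrakk> \<Longrightarrow> wdist w u \<le> C1" using wdist_ball_bounded[of R] by blast
  let ?b = "vertex_point (cone_vertex G)"
  have near: "\<exists>s\<in>{0..dist_l (vertex_point v) ?b}. \<exists>w\<in>carrier G. \<gamma> s \<in> chamber_points G S w \<and> wdist (rep \<tau>) w \<le> C1"
    if nr: "\<tau> \<in> davis_simplices G S" "follows R \<sigma> \<tau>" "v \<in> \<sigma>"
      "geodesic_from_to (davis_points G S) dist_l \<gamma> (vertex_point v) ?b" for \<sigma> \<tau> v \<gamma>
  proof -
    \<comment> \<open>One vertex \<open>u\<close> of \<tau> suffices: \<open>rep \<tau>\<close> lies
      in \<open>u\<close>, so \<open>C1\<close> applies to \<open>rep \<tau>\<close> and any chamber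
      containing \<open>\<gamma> s\<close>.\<close>
    obtain u where u: "u \<in> \<tau>" using davis_simplexD(1)[OF nr(1)] by blast
    have "vertex_point u \<in> closed_simplex \<tau>"
      using vertex_point_closed_simplex u davis_simplexD(2)[OF nr(1)] by blast
    then obtain s where s: "s \<in> {0..dist_l (vertex_point v) ?b}" "dist_l (vertex_point u) (\<gamma> s) \<le> R"
      using nr unfolding follows_def by blast
    then have "\<gamma> s \<in> davis_points G S" using nr by (simp add: geodesic_from_to_def)
    then obtain w where w: "w \<in> carrier G" "\<gamma> s \<in> chamber_points G S w"
      using davis_points_chamber by blast
    have "u \<in> davis_vertices G S" "rep \<tau> \<in> u" using u davis_simplexD(4)[OF nr(1)] rep(2)[OF nr(1)] by blast+
    then show ?thesis using C1 s w by blast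
  qed
  have start: "\<exists>v \<gamma>. v \<in> \<sigma> \<and> geodesic_from_to (davis_points G S) dist_l \<gamma> (vertex_point v) ?b \<and>
      vertex_point v \<in> chamber_points G S (rep \<sigma>)"
    if s: "\<sigma> \<in> davis_simplices G S" for \<sigma>
  proof -
    obtain v where v: "v \<in> \<sigma>" using davis_simplexD(1)[OF s] by blast
    have "vertex_point v \<in> chamber_points G S (rep \<sigma>)"
      using vertex_point_chamber v davis_simplexD(4)[OF s] rep(2)[OF s] by blast
    then show ?thesis
      using v geodesic_exists cone_vertex_chamber chamber_points_subset by (meson subsetD)
  qed
  \<comment> \<open>The estimates yield \<open>C0 + 2 * C1\<close> for the first bound and
    \<open>C0 + 4 * C1\<close> for the second; the constant covers both.\<close>
  show ?thesis
  proof (rule that[of "2 * C0 + 4 * C1"])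
    fix \<sigma> \<tau> assume s: "\<sigma> \<in> davis_simplices G S" and t: "\<tau> \<in> davis_simplices G S" and f: "follows R \<sigma> \<tau>"
    obtain v \<gamma> where v: "v \<in> \<sigma>" "geodesic_from_to (davis_points G S) dist_l \<gamma> (vertex_point v) ?b"
      "vertex_point v \<in> chamber_points G S (rep \<sigma>)" using start[OF s] by blast
    obtain x w where x: "x \<in> {0..dist_l (vertex_point v) ?b}" and w: "w \<in> carrier G"
      "\<gamma> x \<in> chamber_points G S w" "wdist (rep \<tau>) w \<le> C1" using near[OF t f v(1,2)] by blast
    have D: "0 \<in> {0..dist_l (vertex_point v) ?b}" "dist_l (vertex_point v) ?b \<in> {0..dist_l (vertex_point v) ?b}"
      using x by auto
    have "dist_l (vertex_point v) (\<gamma> x) = x" "dist_l (\<gamma> x) ?b = dist_l (vertex_point v) ?b - x"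
      using v(2) D x unfolding geodesic_from_to_def by fastforce+
    then have "wdist (rep \<sigma>) w + wdist w \<one> \<le> wdist (rep \<sigma>) \<one> + C0"
      using C0[OF _ v(3) w(1,2) _ cone_vertex_chamber] rep[OF s] by simp
    moreover have "wdist (rep \<tau>) (rep \<sigma>) \<le> wdist (rep \<tau>) w + wdist w (rep \<sigma>)"
      "wdist (rep \<tau>) \<one> \<le> wdist (rep \<tau>) w + wdist w \<one>" "wdist (rep \<sigma>) w = wdist w (rep \<sigma>)"
      by (intro wdist_triangle wdist_sym rep(1) s t w(1) one_closed)+
    moreover have "wdist (rep \<tau>) \<one> = simplex_length G S \<tau>" "wdist (rep \<sigma>) \<one> = simplex_length G S \<sigma>"
      using wdist_one rep(1,3)[OF s] rep(1,3)[OF t] by simp_all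
    ultimately show "wdist (rep \<tau>) (rep \<sigma>) + simplex_length G S \<tau> \<le> simplex_length G S \<sigma> + (2 * C0 + 4 * C1)"
      using w(3) by linarith
  next
    fix \<sigma> \<tau>1 \<tau>2
    assume s: "\<sigma> \<in> davis_simplices G S" and t: "\<tau>1 \<in> davis_simplices G S" "\<tau>2 \<in> davis_simplices G S"
      and f: "follows R \<sigma> \<tau>1" "follows R \<sigma> \<tau>2"
      and eq: "wdist (rep \<tau>1) (rep \<sigma>) = wdist (rep \<tau>2) (rep \<sigma>)"
    obtain v \<gamma> where v: "v \<in> \<sigma>" "geodesic_from_to (davis_points G S) dist_l \<gamma> (vertex_point v) ?b"
      "vertex_point v \<in> chamber_points G S (rep \<sigma>)" using start[OF s] by blast
    \<comment> \<open>By symmetry \<open>\<gamma> x\<close> may be the earlier point. Going on from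
      \<open>w\<close> to \<open>w'\<close> increases the distance from \<open>rep \<sigma>\<close>
      by \<open>wdist w w'\<close> up to \<open>C0\<close>, but both distances differ from the
      common value by at most \<open>C1\<close>.\<close>
    have ordered: "wdist w w' \<le> C0 + 2 * C1"
      if t: "\<tau> \<in> davis_simplices G S" "\<tau>' \<in> davis_simplices G S"
        and eq: "wdist (rep \<tau>) (rep \<sigma>) = wdist (rep \<tau>') (rep \<sigma>)"
        and x: "x \<in> {0..dist_l (vertex_point v) ?b}" "x' \<in> {0..dist_l (vertex_point v) ?b}" "x \<le> x'"
        and w: "w \<in> carrier G" "\<gamma> x \<in> chamber_points G S w" "wdist (rep \<tau>) w \<le> C1"
        and w': "w' \<in> carrier G" "\<gamma> x' \<in> chamber_points G S w'" "wdist (rep \<tau>') w' \<le> C1"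
      for \<tau> \<tau>' x x' w w'
    proof -
      have "0 \<in> {0..dist_l (vertex_point v) ?b}" using x by auto
      then have "dist_l (vertex_point v) (\<gamma> x) = x" "dist_l (\<gamma> x) (\<gamma> x') = x' - x"
        "dist_l (vertex_point v) (\<gamma> x') = x'"
        using v(2) x unfolding geodesic_from_to_def by fastforce+
      then have "wdist (rep \<sigma>) w + wdist w w' \<le> wdist (rep \<sigma>) w' + C0"
        using C0[OF _ v(3) w(1,2) w'(1,2)] rep[OF s] by simp
      moreover have "wdist (rep \<sigma>) w' \<le> wdist (rep \<sigma>) (rep \<tau>') + wdist (rep \<tau>') w'"
        "wdist (rep \<tau>) (rep \<sigma>) \<le> wdist (rep \<tau>) w + wdist w (rep \<sigma>)" "wdist (rep \<sigma>) w = wdist w (rep \<sigma>)"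
        "wdist (rep \<tau>') (rep \<sigma>) = wdist (rep \<sigma>) (rep \<tau>')"
        by (intro wdist_triangle wdist_sym rep(1) s t w(1) w'(1))+
      ultimately show ?thesis using eq w(3) w'(3) by linarith
    qed
    obtain x w where x: "x \<in> {0..dist_l (vertex_point v) ?b}" and w: "w \<in> carrier G"
      "\<gamma> x \<in> chamber_points G S w" "wdist (rep \<tau>1) w \<le> C1" using near[OF t(1) f(1) v(1,2)] by blast
    obtain x' w' where x': "x' \<in> {0..dist_l (vertex_point v) ?b}" and w': "w' \<in> carrier G"
      "\<gamma> x' \<in> chamber_points G S w'" "wdist (rep \<tau>2) w' \<le> C1" using near[OF t(2) f(2) v(1,2)] by blast
    have "wdist w w' \<le> C0 + 2 * C1"
    proof (cases "x \<le> x'")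
      case True
      then show ?thesis using ordered[OF t eq x x' _ w w'] by blast
    next
      case False
      then show ?thesis
        using ordered[OF t(2,1) eq[symmetric] x' x _ w' w] wdist_sym[OF w(1) w'(1)] by simp
    qed
    moreover have "wdist (rep \<tau>1) (rep \<tau>2) \<le> wdist (rep \<tau>1) w + wdist w (rep \<tau>2)"
      "wdist w (rep \<tau>2) \<le> wdist w w' + wdist w' (rep \<tau>2)" "wdist w' (rep \<tau>2) = wdist (rep \<tau>2) w'"
      by (intro wdist_triangle wdist_sym rep(1) t w(1) w'(1))+
    ultimately show "wdist (rep \<tau>1) (rep \<tau>2) \<le> 2 * C0 + 4 * C1"
      using w(3) w'(3) by linarith
  qed
qed

end

subsection \<open>The Schur test\<close>


lemma sum_fibres_le:
  fixes \<phi> :: "'b \<Rightarrow> real"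
  assumes "finite F" "\<And>y. 0 \<le> \<phi> y" "\<And>y. y \<in> g ` F \<Longrightarrow> real (card {x \<in> F. g x = y}) \<le> m y"
  shows "(\<Sum>x\<in>F. \<phi> (g x)) \<le> (\<Sum>y\<in>g ` F. m y * \<phi> y)"
proof -
  have "(\<Sum>x\<in>F. \<phi> (g x)) = (\<Sum>y\<in>g ` F. \<Sum>x\<in>{x \<in> F. g x = y}. \<phi> (g x))"
    by (rule sum.image_gen[OF assms(1)])
  also have "\<dots> = (\<Sum>y\<in>g ` F. real (card {x \<in> F. g x = y}) * \<phi> y)"
    by (rule sum.cong) auto
  also have "\<dots> \<le> (\<Sum>y\<in>g ` F. m y * \<phi> y)"
    using assms by (intro sum_mono mult_right_mono) auto
  finally show ?thesis .
qed

text \<open>Writing |A c| as sqrt(|A| p) times sqrt(|A| / p) |c|, Cauchy-Schwarz separates the row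
  bound from the column bound. The weight \<open>p\<close> depends on both indices, as it will be a
  power governed by their distance. Finite sums of absolute values are estimated first, which also
  gives convergence of every row.\<close>

lemma weighted_schur_test:
  fixes A :: "'b \<Rightarrow> 'a \<Rightarrow> real" and p :: "'b \<Rightarrow> 'a \<Rightarrow> real"
  assumes pos: "\<And>x. x \<in> X \<Longrightarrow> 0 < h x" "\<And>y. y \<in> Y \<Longrightarrow> 0 < k y"
      "\<And>x y. x \<in> X \<Longrightarrow> y \<in> Y \<Longrightarrow> 0 < p y x"
    and row: "\<And>y E. y \<in> Y \<Longrightarrow> finite E \<Longrightarrow> E \<subseteq> X \<Longrightarrow> (\<Sum>x\<in>E. \<bar>A y x\<bar> * p y x) \<le> K1"
    and col: "\<And>x F. x \<in> X \<Longrightarrow> finite F \<Longrightarrow> F \<subseteq> Y \<Longrightarrow> (\<Sum>y\<in>F. \<bar>A y x\<bar> * k y / p y x) \<le> K2 * h x"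
    and K: "0 \<le> K1" "0 \<le> K2"
    and c: "(\<lambda>x. (c x)\<^sup>2 * h x) summable_on X"
  shows "y \<in> Y \<Longrightarrow> (\<lambda>x. A y x * c x) summable_on X"
    and "(\<lambda>y. (\<Sum>\<^sub>\<infinity>x\<in>X. A y x * c x)\<^sup>2 * k y) summable_on Y"
    and "(\<Sum>\<^sub>\<infinity>y\<in>Y. (\<Sum>\<^sub>\<infinity>x\<in>X. A y x * c x)\<^sup>2 * k y) \<le> K1 * K2 * (\<Sum>\<^sub>\<infinity>x\<in>X. (c x)\<^sup>2 * h x)"
proof -
  define M where "M = K1 * K2 * (\<Sum>\<^sub>\<infinity>x\<in>X. (c x)\<^sup>2 * h x)"
  have fin: "(\<Sum>y\<in>F. (\<Sum>x\<in>E. \<bar>A y x * c x\<bar>)\<^sup>2 * k y) \<le> M"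
    if E: "finite E" "E \<subseteq> X" and F: "finite F" "F \<subseteq> Y" for E F
  proof -
    have "(\<Sum>x\<in>E. \<bar>A y x * c x\<bar>)\<^sup>2 * k y \<le> K1 * (\<Sum>x\<in>E. (c x)\<^sup>2 * (\<bar>A y x\<bar> * k y / p y x))"
      if y: "y \<in> F" for y
    proof -
      have py: "0 < p y x" if "x \<in> E" for x using pos(3) that y E F by blast
      have "(\<Sum>x\<in>E. \<bar>A y x * c x\<bar>) = (\<Sum>x\<in>E. sqrt (\<bar>A y x\<bar> * p y x) * (sqrt (\<bar>A y x\<bar> / p y x) * \<bar>c x\<bar>))"
      proof (rule sum.cong[OF refl])
        fix x assume "x \<in> E"
        then have "sqrt (\<bar>A y x\<bar> * p y x) * sqrt (\<bar>A y x\<bar> / p y x) = \<bar>A y x\<bar>"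
          using py[of x] by (simp flip: real_sqrt_mult)
        then show "\<bar>A y x * c x\<bar> = sqrt (\<bar>A y x\<bar> * p y x) * (sqrt (\<bar>A y x\<bar> / p y x) * \<bar>c x\<bar>)"
          by (simp only: abs_mult mult.assoc[symmetric])
      qed
      then have "(\<Sum>x\<in>E. \<bar>A y x * c x\<bar>)\<^sup>2 \<le>
          (\<Sum>x\<in>E. (sqrt (\<bar>A y x\<bar> * p y x))\<^sup>2) * (\<Sum>x\<in>E. (sqrt (\<bar>A y x\<bar> / p y x) * \<bar>c x\<bar>)\<^sup>2)"
        using Cauchy_Schwarz_ineq_sum by metis
      also have "\<dots> = (\<Sum>x\<in>E. \<bar>A y x\<bar> * p y x) * (\<Sum>x\<in>E. (c x)\<^sup>2 * (\<bar>A y x\<bar> / p y x))"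
        using py by (intro arg_cong2[where f = "(*)"] sum.cong refl)
          (auto simp: power_mult_distrib less_imp_le)
      also have "\<dots> \<le> K1 * (\<Sum>x\<in>E. (c x)\<^sup>2 * (\<bar>A y x\<bar> / p y x))"
        using row[of y E] y E F py by (intro mult_right_mono sum_nonneg) (auto simp: less_imp_le)
      finally have "(\<Sum>x\<in>E. \<bar>A y x * c x\<bar>)\<^sup>2 * k y \<le> K1 * (\<Sum>x\<in>E. (c x)\<^sup>2 * (\<bar>A y x\<bar> / p y x)) * k y"
        using pos(2)[of y] y F by (intro mult_right_mono) auto
      also have "\<dots> = K1 * (\<Sum>x\<in>E. (c x)\<^sup>2 * (\<bar>A y x\<bar> * k y / p y x))"
        by (simp add: sum_distrib_left sum_distrib_right algebra_simps)
      finally show ?thesis .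
    qed
    then have "(\<Sum>y\<in>F. (\<Sum>x\<in>E. \<bar>A y x * c x\<bar>)\<^sup>2 * k y) \<le>
        (\<Sum>y\<in>F. K1 * (\<Sum>x\<in>E. (c x)\<^sup>2 * (\<bar>A y x\<bar> * k y / p y x)))" by (rule sum_mono)
    also have "\<dots> = K1 * (\<Sum>x\<in>E. (c x)\<^sup>2 * (\<Sum>y\<in>F. \<bar>A y x\<bar> * k y / p y x))"
      unfolding sum_distrib_left by (rule sum.swap)
    also have "\<dots> \<le> K1 * (\<Sum>x\<in>E. (c x)\<^sup>2 * (K2 * h x))"
      using K E F col by (intro mult_left_mono sum_mono) auto
    also have "\<dots> = K1 * K2 * (\<Sum>x\<in>E. (c x)\<^sup>2 * h x)"
      by (simp add: sum_distrib_left algebra_simps)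
    also have "\<dots> \<le> M"
      unfolding M_def using K E c pos(1)
      by (intro mult_left_mono finite_sum_le_infsum) (auto simp: less_imp_le)
    finally show ?thesis .
  qed
  show summ: "(\<lambda>x. A y x * c x) summable_on X" if y: "y \<in> Y" for y
  proof -
    have "(\<Sum>x\<in>E. norm (A y x * c x)) \<le> sqrt (M / k y)" if "finite E" "E \<subseteq> X" for E
    proof (rule real_le_rsqrt)
      \<comment> \<open>The finite estimate for the single row \<open>y\<close>, divided by the
        positive weight \<open>k y\<close>.\<close>
      show "(\<Sum>x\<in>E. norm (A y x * c x))\<^sup>2 \<le> M / k y"
        using fin[OF that, of "{y}"] y pos(2)[OF y] by (simp add: pos_le_divide_eq)
    qed
    then have "(\<lambda>x. norm (A y x * c x)) summable_on X"
      by (intro nonneg_bdd_above_summable_on bdd_aboveI[where M = "sqrt (M / k y)"]) auto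
    then show ?thesis by (rule abs_summable_summable)
  qed
  \<comment> \<open>For fixed finite \<open>F\<close> the set \<open>E\<close> grows to
    \<open>X\<close>; a finite sum of squares of convergent sums passes to the limit.\<close>
  have part: "(\<Sum>y\<in>F. (\<Sum>\<^sub>\<infinity>x\<in>X. A y x * c x)\<^sup>2 * k y) \<le> M" if F: "finite F" "F \<subseteq> Y" for F
  proof (rule tendsto_upperbound)
    show "((\<lambda>E. \<Sum>y\<in>F. (\<Sum>x\<in>E. A y x * c x)\<^sup>2 * k y) \<longlongrightarrow>
        (\<Sum>y\<in>F. (\<Sum>\<^sub>\<infinity>x\<in>X. A y x * c x)\<^sup>2 * k y)) (finite_subsets_at_top X)"
      using F summ by (intro tendsto_intros infsum_tendsto) auto
    show "\<forall>\<^sub>F E in finite_subsets_at_top X. (\<Sum>y\<in>F. (\<Sum>x\<in>E. A y x * c x)\<^sup>2 * k y) \<le> M"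
    proof (rule eventually_finite_subsets_at_top_weakI)
      fix E assume E: "finite E" "E \<subseteq> X"
      have "(\<Sum>x\<in>E. A y x * c x)\<^sup>2 \<le> (\<Sum>x\<in>E. \<bar>A y x * c x\<bar>)\<^sup>2" for y
        using sum_abs[of "\<lambda>x. A y x * c x" E] by (metis abs_ge_zero order_trans power2_abs power_mono)
      then have "(\<Sum>y\<in>F. (\<Sum>x\<in>E. A y x * c x)\<^sup>2 * k y) \<le> (\<Sum>y\<in>F. (\<Sum>x\<in>E. \<bar>A y x * c x\<bar>)\<^sup>2 * k y)"
        using F pos(2) by (intro sum_mono mult_right_mono) (auto simp: less_imp_le subset_iff)
      then show "(\<Sum>y\<in>F. (\<Sum>x\<in>E. A y x * c x)\<^sup>2 * k y) \<le> M" using fin[OF E F] by linarith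
    qed
  qed simp
  show S: "(\<lambda>y. (\<Sum>\<^sub>\<infinity>x\<in>X. A y x * c x)\<^sup>2 * k y) summable_on Y"
  proof (rule nonneg_bdd_above_summable_on)
    show "0 \<le> (\<Sum>\<^sub>\<infinity>x\<in>X. A y x * c x)\<^sup>2 * k y" if "y \<in> Y" for y
      using pos(2)[OF that] by simp
    show "bdd_above (sum (\<lambda>y. (\<Sum>\<^sub>\<infinity>x\<in>X. A y x * c x)\<^sup>2 * k y) ` {F. F \<subseteq> Y \<and> finite F})"
      by (rule bdd_aboveI2[where M = M]) (use part in simp)
  qed
  show "(\<Sum>\<^sub>\<infinity>y\<in>Y. (\<Sum>\<^sub>\<infinity>x\<in>X. A y x * c x)\<^sup>2 * k y) \<le> K1 * K2 * (\<Sum>\<^sub>\<infinity>x\<in>X. (c x)\<^sup>2 * h x)"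
    unfolding M_def[symmetric] by (rule infsum_le_finite_sums[OF S part])
qed

text \<open>Any \<beta> strictly between 1/t and the radius of convergence will do. In
  \<open>ereal\<close> the quotient 1/0 is infinite, so radius 0 is excluded; for infinite radius
  the hypothesis says that \<open>t\<close> is positive.\<close>

lemma growth_summable:
  assumes "1 / growth_radius G S < ereal t"
  obtains \<beta> where "0 < \<beta>" "0 < t" "1 < t * \<beta>" "summable (\<lambda>n. growth_coeff G S n * \<beta> ^ n)"
proof -
  let ?\<rho> = "growth_radius G S"
  have \<rho>: "0 \<le> ?\<rho>" by (simp add: growth_radius_def conv_radius_nonneg)
  then have "0 \<le> 1 / ?\<rho>" by simp
  then have t: "0 < t" using assms by (metis ereal_less(2) order_le_less_trans)
  have "ereal (1 / t) < ?\<rho>"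
  proof (cases ?\<rho>)
    case (real r)
    then have "r \<noteq> 0" using assms by (auto simp: divide_ereal_def)
    then have "0 < r" using \<rho> real by simp
    then show ?thesis using assms t real by (simp add: field_simps one_ereal_def)
  qed (use \<rho> in auto)
  then obtain \<beta> where \<beta>: "1 / t < \<beta>" "ereal \<beta> < ?\<rho>"
    by (metis ereal_dense2 less_ereal.simps(1))
  have "0 < \<beta>" using \<beta>(1) t by (meson divide_pos_pos less_trans zero_less_one)
  moreover have "1 < t * \<beta>" using \<beta>(1) t by (simp add: field_simps)
  moreover have "summable (\<lambda>n. growth_coeff G S n * \<beta> ^ n)"
    using \<beta>(2) \<open>0 < \<beta>\<close> by (intro summable_in_conv_radius) (simp add: growth_radius_def)
  ultimately show ?thesis using that t by blast
qed

section \<open>Row and column sums over the Davis complex\<close>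

context davis_complex
begin

lemma row_sum_bound:
  assumes \<beta>: "0 < \<beta>" "summable (\<lambda>n. growth_coeff G S n * \<beta> ^ n)"
    and \<tau>: "\<tau> \<in> davis_simplices G S" and F: "finite F" "F \<subseteq> davis_simplices G S"
  shows "(\<Sum>\<sigma>\<in>F. \<beta> ^ wdist (rep \<tau>) (rep \<sigma>)) \<le> 2 ^ 2 ^ card S * (\<Sum>n. growth_coeff G S n * \<beta> ^ n)"
proof -
  define g where "g \<sigma> = inv (rep \<tau>) \<otimes> rep \<sigma>" for \<sigma>
  have gc: "g \<sigma> \<in> carrier G" "rep \<tau> \<otimes> g \<sigma> = rep \<sigma>" if "\<sigma> \<in> F" for \<sigma>
    using rep(1)[OF \<tau>] rep(1)[of \<sigma>] F that by (auto simp: g_def m_assoc[symmetric])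
  have "(\<Sum>\<sigma>\<in>F. \<beta> ^ len (g \<sigma>)) \<le> (\<Sum>u\<in>g ` F. 2 ^ 2 ^ card S * \<beta> ^ len u)"
  proof (rule sum_fibres_le[OF F(1)])
    fix u
    have "{\<sigma> \<in> F. g \<sigma> = u} \<subseteq> {\<sigma> \<in> davis_simplices G S. rep \<tau> \<otimes> u \<in> \<Inter>\<sigma>}"
      using gc rep(2) F by force
    then have "card {\<sigma> \<in> F. g \<sigma> = u} \<le> 2 ^ 2 ^ card S"
      using card_simplices_chamber[of "rep \<tau> \<otimes> u"] card_mono order_trans by blast
    then show "real (card {\<sigma> \<in> F. g \<sigma> = u}) \<le> 2 ^ 2 ^ card S"
      by (metis of_nat_le_iff of_nat_numeral of_nat_power)
  qed (use \<beta> in simp)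
  also have "\<dots> = 2 ^ 2 ^ card S * (\<Sum>u\<in>g ` F. \<beta> ^ len u)" by (simp add: sum_distrib_left)
  also have "(\<Sum>u\<in>g ` F. \<beta> ^ len u) \<le> (\<Sum>n\<in>len ` g ` F. growth_coeff G S n * \<beta> ^ n)"
  proof (rule sum_fibres_le)
    fix n
    have "finite {w \<in> carrier G. len w = n}" by (rule finite_subset[OF _ finite_len_le[of n]]) auto
    then show "real (card {u \<in> g ` F. len u = n}) \<le> growth_coeff G S n"
      unfolding growth_coeff_def using gc by (intro of_nat_mono card_mono) auto
  qed (use \<beta> F in auto)
  also have "\<dots> \<le> (\<Sum>n. growth_coeff G S n * \<beta> ^ n)"
    using \<beta> F by (intro sum_le_suminf) (auto simp: growth_coeff_def)
  finally show ?thesis by (simp add: g_def)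
qed

text \<open>All these simplices have representatives within \<open>C\<close> of that of any one of
  them, \<open>\<tau>0\<close>. The bound is the number of elements of length at most
  \<open>C\<close> times the number of simplices per chamber, uniform in \<sigma> and
  \<open>n\<close>.\<close>

lemma follows_card:
  obtains B :: nat where "\<And>\<sigma> F n. \<lbrakk>\<sigma> \<in> davis_simplices G S; F \<subseteq> davis_simplices G S; \<forall>\<tau>\<in>F. follows R \<sigma> \<tau>\<rbrakk> \<Longrightarrow>
    card {\<tau> \<in> F. wdist (rep \<tau>) (rep \<sigma>) = n} \<le> B"
proof -
  obtain C where C: "\<And>\<sigma> \<tau> \<tau>'. \<lbrakk>\<sigma> \<in> davis_simplices G S; \<tau> \<in> davis_simplices G S; \<tau>' \<in> davis_simplices G S;
      follows R \<sigma> \<tau>; follows R \<sigma> \<tau>'; wdist (rep \<tau>) (rep \<sigma>) = wdist (rep \<tau>') (rep \<sigma>)\<rbrakk> \<Longrightarrow>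
      wdist (rep \<tau>) (rep \<tau>') \<le> C" using follows_bounds[of R] by metis
  let ?U = "{w \<in> carrier G. len w \<le> C}"
  let ?N = "\<lambda>w. {\<tau> \<in> davis_simplices G S. w \<in> \<Inter>\<tau>}"
  show ?thesis
  proof (rule that[of "card ?U * 2 ^ 2 ^ card S"])
    fix \<sigma> F n
    assume s: "\<sigma> \<in> davis_simplices G S" and F: "F \<subseteq> davis_simplices G S" "\<forall>\<tau>\<in>F. follows R \<sigma> \<tau>"
    let ?E = "{\<tau> \<in> F. wdist (rep \<tau>) (rep \<sigma>) = n}"
    show "card ?E \<le> card ?U * 2 ^ 2 ^ card S"
    proof (cases "?E = {}")
      case False
      then obtain \<tau>0 where t0: "\<tau>0 \<in> ?E" by blast
      then have t0s: "\<tau>0 \<in> davis_simplices G S" using F by blast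
      have "?E \<subseteq> (\<Union>u\<in>?U. ?N (rep \<tau>0 \<otimes> u))"
      proof
        fix \<tau> assume t: "\<tau> \<in> ?E"
        then have ts: "\<tau> \<in> davis_simplices G S" using F by blast
        have "wdist (rep \<tau>0) (rep \<tau>) \<le> C"
          using C[OF s t0s ts] t t0 F by simp
        then have "inv (rep \<tau>0) \<otimes> rep \<tau> \<in> ?U" using rep(1)[OF t0s] rep(1)[OF ts] by simp
        moreover have "rep \<tau>0 \<otimes> (inv (rep \<tau>0) \<otimes> rep \<tau>) = rep \<tau>"
          using rep(1)[OF t0s] rep(1)[OF ts] by (simp add: m_assoc[symmetric])
        ultimately show "\<tau> \<in> (\<Union>u\<in>?U. ?N (rep \<tau>0 \<otimes> u))"
          using ts rep(2)[OF ts] by (intro UN_I[of "inv (rep \<tau>0) \<otimes> rep \<tau>"]) auto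
      qed
      moreover have "finite (\<Union>u\<in>?U. ?N (rep \<tau>0 \<otimes> u))"
        using finite_len_le card_simplices_chamber(1) by (intro finite_UN_I)
      ultimately have "card ?E \<le> card (\<Union>u\<in>?U. ?N (rep \<tau>0 \<otimes> u))" by (intro card_mono)
      also have "\<dots> \<le> (\<Sum>u\<in>?U. card (?N (rep \<tau>0 \<otimes> u)))" by (rule card_UN_le[OF finite_len_le])
      also have "\<dots> \<le> card ?U * 2 ^ 2 ^ card S"
        using sum_bounded_above[of ?U "\<lambda>u. card (?N (rep \<tau>0 \<otimes> u))" "2 ^ 2 ^ card S"]
          card_simplices_chamber(2) by simp
      finally show ?thesis .
    qed (simp only: card.empty)
  qed
qed

text \<open>The relation between the two lengths turns each summand into t^d(\<sigma>) times a
  bounded factor times \<theta>^n, and a bounded number of simplices share the same n.\<close>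

lemma column_sum_bound:
  fixes t \<beta> :: real
  assumes "0 < t" "0 < \<beta>" "1 < t * \<beta>"
  obtains K where "0 \<le> K" "\<And>\<sigma> F. \<lbrakk>\<sigma> \<in> davis_simplices G S; finite F; F \<subseteq> davis_simplices G S; \<forall>\<tau>\<in>F. follows R \<sigma> \<tau>\<rbrakk> \<Longrightarrow>
    (\<Sum>\<tau>\<in>F. t ^ simplex_length G S \<tau> / \<beta> ^ wdist (rep \<tau>) (rep \<sigma>)) \<le> K * t ^ simplex_length G S \<sigma>"
proof -
  obtain C where C: "\<And>\<sigma> \<tau>. \<lbrakk>\<sigma> \<in> davis_simplices G S; \<tau> \<in> davis_simplices G S; follows R \<sigma> \<tau>\<rbrakk> \<Longrightarrow>
      wdist (rep \<tau>) (rep \<sigma>) + simplex_length G S \<tau> \<le> simplex_length G S \<sigma> + C"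
    using follows_bounds[of R] by metis
  obtain B :: nat where B: "\<And>\<sigma> F n. \<lbrakk>\<sigma> \<in> davis_simplices G S; F \<subseteq> davis_simplices G S; \<forall>\<tau>\<in>F. follows R \<sigma> \<tau>\<rbrakk> \<Longrightarrow>
    card {\<tau> \<in> F. wdist (rep \<tau>) (rep \<sigma>) = n} \<le> B" using follows_card[of R] by blast
  define \<theta> where "\<theta> = 1 / (t * \<beta>)"
  have \<theta>: "0 < \<theta>" "\<theta> < 1"
    using mult_pos_pos[OF assms(1,2)] assms(3) by (simp_all only: \<theta>_def zero_less_divide_1_iff divide_less_eq_1_pos)
  \<comment> \<open>Only positivity of \<open>t\<close> is known, and \<open>t\<close> can be below
    1 when the group is finite; the maximum bounds \<open>t ^ j\<close> for every j \<le> C in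
    either case.\<close>
  let ?m = "max 1 t ^ C"
  show ?thesis
  proof (rule that[of "?m * (B * (\<Sum>n. \<theta> ^ n))"])
    show "0 \<le> ?m * (B * (\<Sum>n. \<theta> ^ n))"
      using \<theta> summable_geometric[of \<theta>] by (intro mult_nonneg_nonneg suminf_nonneg) auto
    fix \<sigma> F
    assume s: "\<sigma> \<in> davis_simplices G S" and F: "finite F" "F \<subseteq> davis_simplices G S" "\<forall>\<tau>\<in>F. follows R \<sigma> \<tau>"
    have "t ^ simplex_length G S \<tau> / \<beta> ^ wdist (rep \<tau>) (rep \<sigma>) \<le>
        ?m * t ^ simplex_length G S \<sigma> * \<theta> ^ wdist (rep \<tau>) (rep \<sigma>)" if t: "\<tau> \<in> F" for \<tau>
    proof -
      define n where "n = wdist (rep \<tau>) (rep \<sigma>)"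
      have ts: "\<tau> \<in> davis_simplices G S" using t F by blast
      note r = rep[OF s] and r' = rep[OF ts]
      have "simplex_length G S \<sigma> \<le> n + simplex_length G S \<tau>"
        using wdist_triangle[OF r(1) r'(1) one_closed] wdist_one[OF r(1)] wdist_one[OF r'(1)]
          wdist_sym[OF r(1) r'(1)] r(3) r'(3) by (simp add: n_def)
      \<comment> \<open>The triangle inequality makes the error \<open>j\<close> a natural number;
        \<open>follows_bounds\<close> bounds it by \<open>C\<close>.\<close>
      then obtain j where j: "n + simplex_length G S \<tau> = simplex_length G S \<sigma> + j"
        using le_iff_add by metis
      then have "j \<le> C" using C[OF s ts] t F by (simp add: n_def)
      have "t ^ j \<le> max 1 t ^ j" using assms by (intro power_mono) auto
      also have "\<dots> \<le> ?m" using \<open>j \<le> C\<close> by (intro power_increasing) auto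
      finally have "t ^ (n + simplex_length G S \<tau>) \<le> t ^ simplex_length G S \<sigma> * ?m"
        unfolding j power_add using assms by (intro mult_left_mono) auto
      then show ?thesis
        unfolding n_def[symmetric] using assms
        by (simp add: \<theta>_def power_divide power_mult_distrib power_add field_simps)
    qed
    then have "(\<Sum>\<tau>\<in>F. t ^ simplex_length G S \<tau> / \<beta> ^ wdist (rep \<tau>) (rep \<sigma>)) \<le>
        (\<Sum>\<tau>\<in>F. ?m * t ^ simplex_length G S \<sigma> * \<theta> ^ wdist (rep \<tau>) (rep \<sigma>))" by (rule sum_mono)
    also have "\<dots> = ?m * t ^ simplex_length G S \<sigma> * (\<Sum>\<tau>\<in>F. \<theta> ^ wdist (rep \<tau>) (rep \<sigma>))"
      by (simp add: sum_distrib_left)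
    also have "(\<Sum>\<tau>\<in>F. \<theta> ^ wdist (rep \<tau>) (rep \<sigma>)) \<le> (\<Sum>n\<in>(\<lambda>\<tau>. wdist (rep \<tau>) (rep \<sigma>)) ` F. B * \<theta> ^ n)"
      using B[OF s F(2,3)] \<theta> F by (intro sum_fibres_le) auto
    also have "\<dots> \<le> B * (\<Sum>n. \<theta> ^ n)"
      unfolding sum_distrib_left[symmetric] using \<theta> F
      by (intro mult_left_mono sum_le_suminf summable_geometric) auto
    finally show "(\<Sum>\<tau>\<in>F. t ^ simplex_length G S \<tau> / \<beta> ^ wdist (rep \<tau>) (rep \<sigma>)) \<le>
        ?m * (B * (\<Sum>n. \<theta> ^ n)) * t ^ simplex_length G S \<sigma>"
      using assms by (simp add: mult_ac mult_left_mono)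
  qed
qed

end

section \<open>The matrix of the homotopy and its extension\<close>

lemma simplex_chain_fin: "\<sigma> \<in> davis_simplices G S \<Longrightarrow> simplex_chain \<sigma> \<in> fin_kchains G S (card \<sigma> - 1)"
  using card_gt_0_iff[of \<sigma>]
  by (simp add: fin_kchains_def fin_chains_def simplex_chain_def) (simp add: davis_simplices_def)

text \<open>Linearity is available on finitely supported chains only, so the induction over the
  support also carries that the partial sums are such chains. The formula exhibits the matrix of
  \<open>H\<close>.\<close>

lemma linear_on_fin_chains:
  assumes add: "\<forall>c1 \<in> fin_chains G S. \<forall>c2 \<in> fin_chains G S.
                  H (\<lambda>\<tau>. c1 \<tau> + c2 \<tau>) = (\<lambda>\<tau>. H c1 \<tau> + H c2 \<tau>)"
    and scale: "\<forall>a. \<forall>c \<in> fin_chains G S. H (\<lambda>\<tau>. a * c \<tau>) = (\<lambda>\<tau>. a * H c \<tau>)"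
    and c: "c \<in> fin_chains G S"
  shows "H c = (\<lambda>\<tau>. \<Sum>\<sigma> | c \<sigma> \<noteq> 0. c \<sigma> * H (simplex_chain \<sigma>) \<tau>)"
proof -
  have "(\<lambda>\<tau>. \<Sum>\<sigma>\<in>E. c \<sigma> * simplex_chain \<sigma> \<tau>) \<in> fin_chains G S \<and>
      H (\<lambda>\<tau>. \<Sum>\<sigma>\<in>E. c \<sigma> * simplex_chain \<sigma> \<tau>) = (\<lambda>\<tau>. \<Sum>\<sigma>\<in>E. c \<sigma> * H (simplex_chain \<sigma>) \<tau>)"
    if "finite E" "E \<subseteq> davis_simplices G S" for E
    using that
  proof (induction E)
    case empty
    have z: "(\<lambda>_. 0) \<in> fin_chains G S" by (simp add: fin_chains_def)
    then show ?case using scale[rule_format, OF z, of 0] by simp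
  next
    case (insert \<sigma> E)
    let ?s = "\<lambda>\<tau>. \<Sum>\<sigma>\<in>E. c \<sigma> * simplex_chain \<sigma> \<tau>"
    have s: "?s \<in> fin_chains G S"
      and Hs: "H ?s = (\<lambda>\<tau>. \<Sum>\<sigma>\<in>E. c \<sigma> * H (simplex_chain \<sigma>) \<tau>)" using insert by auto
    have \<sigma>: "simplex_chain \<sigma> \<in> fin_chains G S" using insert simplex_chain_fin by (auto simp: fin_kchains_def)
    have \<sigma>': "(\<lambda>\<tau>. c \<sigma> * simplex_chain \<sigma> \<tau>) \<in> fin_chains G S"
      using insert by (auto simp: fin_chains_def simplex_chain_def)
    have "{\<tau>. c \<sigma> * simplex_chain \<sigma> \<tau> + ?s \<tau> \<noteq> 0} \<subseteq> {\<tau>. c \<sigma> * simplex_chain \<sigma> \<tau> \<noteq> 0} \<union> {\<tau>. ?s \<tau> \<noteq> 0}"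
      by auto
    then have "(\<lambda>\<tau>. c \<sigma> * simplex_chain \<sigma> \<tau> + ?s \<tau>) \<in> fin_chains G S"
      using s \<sigma>' unfolding fin_chains_def by (blast intro: finite_subset)
    then show ?case
      using insert.hyps Hs add[rule_format, OF \<sigma>' s] scale[rule_format, OF \<sigma>, of "c \<sigma>"] by simp
  qed
  note lin = this
  have "finite {\<sigma>. c \<sigma> \<noteq> 0}" "{\<sigma>. c \<sigma> \<noteq> 0} \<subseteq> davis_simplices G S"
    using c by (auto simp: fin_chains_def)
  note lin = lin[OF this]
  have "(\<lambda>\<tau>. \<Sum>\<sigma> | c \<sigma> \<noteq> 0. c \<sigma> * simplex_chain \<sigma> \<tau>) = c"
  proof
    fix \<tau>
    have "(\<Sum>\<sigma> | c \<sigma> \<noteq> 0. c \<sigma> * simplex_chain \<sigma> \<tau>) = (\<Sum>\<sigma> | c \<sigma> \<noteq> 0. if \<sigma> = \<tau> then c \<sigma> else 0)"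
      by (rule sum.cong) (auto simp: simplex_chain_def)
    also have "\<dots> = c \<tau>" using c by (simp add: fin_chains_def)
    finally show "(\<Sum>\<sigma> | c \<sigma> \<noteq> 0. c \<sigma> * simplex_chain \<sigma> \<tau>) = c \<tau>" .
  qed
  then show ?thesis using lin by simp
qed

theorem theorem10p1:
  fixes G :: "'w monoid" and S :: "'w set" and dM :: "'w point \<Rightarrow> 'w point \<Rightarrow> real"
    and t :: real and H :: "'w chain \<Rightarrow> 'w chain"
  assumes cox: "coxeter_system G S"
    and metric: "moussong_type_metric G S dM"
    and t_gt: "1 / growth_radius G S < ereal t"
    and H_add: "\<forall>c1 \<in> fin_chains G S. \<forall>c2 \<in> fin_chains G S.
                  H (\<lambda>\<tau>. c1 \<tau> + c2 \<tau>) = (\<lambda>\<tau>. H c1 \<tau> + H c2 \<tau>)"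
    and H_scale: "\<forall>a. \<forall>c \<in> fin_chains G S. H (\<lambda>\<tau>. a * c \<tau>) = (\<lambda>\<tau>. a * H c \<tau>)"
    and H_deg: "\<forall>k. \<forall>c \<in> fin_kchains G S k. H c \<in> fin_kchains G S (Suc k)"
    and H_a: "\<forall>v \<in> davis_vertices G S.
                boundary G S (H (simplex_chain {v})) =
                  (\<lambda>\<tau>. simplex_chain {v} \<tau> - simplex_chain {cone_vertex G} \<tau>)"
    and H_b: "\<forall>\<sigma> \<in> davis_simplices G S. 2 \<le> card \<sigma> \<longrightarrow>
                boundary G S (H (simplex_chain \<sigma>)) =
                  (\<lambda>\<tau>. simplex_chain \<sigma> \<tau> - H (boundary G S (simplex_chain \<sigma>)) \<tau>)"
    and H_c: "\<exists>C. \<forall>\<sigma> \<in> davis_simplices G S. \<forall>\<tau>. \<bar>H (simplex_chain \<sigma>) \<tau>\<bar> < C"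
    and H_d: "\<exists>R. \<forall>\<sigma> \<in> davis_simplices G S. \<forall>v \<in> \<sigma>. \<forall>\<gamma>.
                geodesic_from_to (davis_points G S) dM \<gamma> (vertex_point v) (vertex_point (cone_vertex G)) \<longrightarrow>
                (\<forall>\<tau>. H (simplex_chain \<sigma>) \<tau> \<noteq> 0 \<longrightarrow>
                   (\<forall>p \<in> closed_simplex \<tau>. \<exists>s \<in> {0 .. dM (vertex_point v) (vertex_point (cone_vertex G))}.
                       dM p (\<gamma> s) \<le> R))"
  shows "\<exists>T K. (\<forall>c \<in> l2t_chains G S t. T c \<in> l2t_chains G S t) \<and>
           (\<forall>c1 \<in> l2t_chains G S t. \<forall>c2 \<in> l2t_chains G S t.
               T (\<lambda>\<tau>. c1 \<tau> + c2 \<tau>) = (\<lambda>\<tau>. T c1 \<tau> + T c2 \<tau>)) \<and>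
           (\<forall>a. \<forall>c \<in> l2t_chains G S t. T (\<lambda>\<tau>. a * c \<tau>) = (\<lambda>\<tau>. a * T c \<tau>)) \<and>
           (\<forall>c \<in> l2t_chains G S t. l2t_norm G S t (T c) \<le> K * l2t_norm G S t c) \<and>
           (\<forall>c \<in> fin_chains G S. T c = H c)"
proof -
  obtain l where l: "pe_edge_lengths G S l" "W_invariant_lengths G S l" and dM: "dM = pe_dist G S l"
    using metric by (auto simp: moussong_type_metric_def)
  interpret davis_complex G S l
    using cox metric l dM by unfold_locales (auto simp: moussong_type_metric_def)
  obtain \<beta> where \<beta>: "0 < \<beta>" "0 < t" "1 < t * \<beta>" "summable (\<lambda>n. growth_coeff G S n * \<beta> ^ n)"
    using growth_summable[OF t_gt] .
  obtain C where C: "\<And>\<sigma> \<tau>. \<sigma> \<in> davis_simplices G S \<Longrightarrow> \<bar>H (simplex_chain \<sigma>) \<tau>\<bar> < C" using H_c by blast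
  obtain R where "\<forall>\<sigma> \<in> davis_simplices G S. \<forall>v \<in> \<sigma>. \<forall>\<gamma>.
      geodesic_from_to (davis_points G S) dist_l \<gamma> (vertex_point v) (vertex_point (cone_vertex G)) \<longrightarrow>
      (\<forall>\<tau>. H (simplex_chain \<sigma>) \<tau> \<noteq> 0 \<longrightarrow>
         (\<forall>p \<in> closed_simplex \<tau>. \<exists>s \<in> {0 .. dist_l (vertex_point v) (vertex_point (cone_vertex G))}.
             dist_l p (\<gamma> s) \<le> R))"
    using H_d unfolding dM by (elim exE) (rule that)
  then have R: "follows R \<sigma> \<tau>" if "\<sigma> \<in> davis_simplices G S" "H (simplex_chain \<sigma>) \<tau> \<noteq> 0" for \<sigma> \<tau>
    unfolding follows_def using that by (intro ballI allI impI) blast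
  obtain K where K: "0 \<le> K" "\<And>\<sigma> F. \<lbrakk>\<sigma> \<in> davis_simplices G S; finite F; F \<subseteq> davis_simplices G S; \<forall>\<tau>\<in>F. follows R \<sigma> \<tau>\<rbrakk> \<Longrightarrow>
    (\<Sum>\<tau>\<in>F. t ^ simplex_length G S \<tau> / \<beta> ^ wdist (rep \<tau>) (rep \<sigma>)) \<le> K * t ^ simplex_length G S \<sigma>"
    using column_sum_bound[OF \<beta>(2,1,3), of R] by blast
  \<comment> \<open>A bound on absolute values is nonnegative once there is a simplex; the cone
    vertex provides one.\<close>
  have C0: "0 \<le> C" using C[OF davis_singleton[OF cone_vertex_vertex]] by (meson abs_ge_zero less_imp_le order_trans)
  define A where "A \<tau> \<sigma> = H (simplex_chain \<sigma>) \<tau>" for \<tau> \<sigma>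
  let ?X = "davis_simplices G S" and ?h = "\<lambda>\<sigma>. t ^ simplex_length G S \<sigma>"
  define K1 where "K1 = C * (2 ^ 2 ^ card S * (\<Sum>n. growth_coeff G S n * \<beta> ^ n))"
  have A_le: "\<bar>A \<tau> \<sigma>\<bar> \<le> C" if "\<sigma> \<in> ?X" for \<sigma> \<tau> using C[OF that] by (simp add: A_def less_imp_le)
  have row: "(\<Sum>\<sigma>\<in>E. \<bar>A \<tau> \<sigma>\<bar> * \<beta> ^ wdist (rep \<tau>) (rep \<sigma>)) \<le> K1"
    if "\<tau> \<in> ?X" "finite E" "E \<subseteq> ?X" for \<tau> E
  proof -
    have "(\<Sum>\<sigma>\<in>E. \<bar>A \<tau> \<sigma>\<bar> * \<beta> ^ wdist (rep \<tau>) (rep \<sigma>)) \<le> (\<Sum>\<sigma>\<in>E. C * \<beta> ^ wdist (rep \<tau>) (rep \<sigma>))"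
      using \<beta> A_le that by (intro sum_mono mult_right_mono) auto
    also have "\<dots> \<le> K1"
      unfolding K1_def sum_distrib_left[symmetric]
      using row_sum_bound[OF \<beta>(1,4) that] C0 by (rule mult_left_mono)
    finally show ?thesis .
  qed
  have col: "(\<Sum>\<tau>\<in>F. \<bar>A \<tau> \<sigma>\<bar> * ?h \<tau> / \<beta> ^ wdist (rep \<tau>) (rep \<sigma>)) \<le> C * K * ?h \<sigma>"
    if "\<sigma> \<in> ?X" "finite F" "F \<subseteq> ?X" for \<sigma> F
  proof -
    \<comment> \<open>Only \<tau> in the support of H(\<sigma>) contribute, and for these condition
      (d) gives \<open>follows R \<sigma> \<tau>\<close>.\<close>
    let ?F = "{\<tau> \<in> F. A \<tau> \<sigma> \<noteq> 0}"
    have "(\<Sum>\<tau>\<in>F. \<bar>A \<tau> \<sigma>\<bar> * ?h \<tau> / \<beta> ^ wdist (rep \<tau>) (rep \<sigma>)) =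
        (\<Sum>\<tau>\<in>?F. \<bar>A \<tau> \<sigma>\<bar> * ?h \<tau> / \<beta> ^ wdist (rep \<tau>) (rep \<sigma>))"
      using that by (intro sum.mono_neutral_right) auto
    also have "\<dots> \<le> (\<Sum>\<tau>\<in>?F. C * (?h \<tau> / \<beta> ^ wdist (rep \<tau>) (rep \<sigma>)))"
      unfolding times_divide_eq_right[symmetric] using \<beta> A_le that by (intro sum_mono mult_right_mono) auto
    also have "\<dots> \<le> C * (K * ?h \<sigma>)"
      unfolding sum_distrib_left[symmetric]
      using K(2)[OF that(1), of ?F] that R C0 by (intro mult_left_mono) (auto simp: A_def)
    finally show ?thesis by (simp add: mult.assoc)
  qed
  \<comment> \<open>The row bound for the empty sum.\<close>
  have K1: "0 \<le> K1" using row[of "{cone_vertex G}" "{}"] davis_singleton[OF cone_vertex_vertex] by simp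
  have CK: "0 \<le> C * K" using C0 K(1) by simp
  have pos: "0 < ?h \<sigma>" "0 < \<beta> ^ wdist (rep \<tau>) (rep \<sigma>)" for \<sigma> \<tau> using \<beta> by auto
  \<comment> \<open>The extension is given by the matrix of \<open>H\<close>; the value 0 off the
    simplices keeps \<open>T c\<close> supported on them.\<close>
  define T where "T c = (\<lambda>\<tau>. if \<tau> \<in> ?X then \<Sum>\<^sub>\<infinity>\<sigma>\<in>?X. A \<tau> \<sigma> * c \<sigma> else 0)" for c
  have l2: "(\<lambda>\<sigma>. (c \<sigma>)\<^sup>2 * ?h \<sigma>) summable_on ?X" if "c \<in> l2t_chains G S t" for c
    using that by (simp add: l2t_chains_def)
  have summ: "\<tau> \<in> ?X \<Longrightarrow> (\<lambda>\<sigma>. A \<tau> \<sigma> * c \<sigma>) summable_on ?X"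
    and sum2: "(\<lambda>\<tau>. (\<Sum>\<^sub>\<infinity>\<sigma>\<in>?X. A \<tau> \<sigma> * c \<sigma>)\<^sup>2 * ?h \<tau>) summable_on ?X"
    and norm2: "(\<Sum>\<^sub>\<infinity>\<tau>\<in>?X. (\<Sum>\<^sub>\<infinity>\<sigma>\<in>?X. A \<tau> \<sigma> * c \<sigma>)\<^sup>2 * ?h \<tau>) \<le> K1 * (C * K) * (\<Sum>\<^sub>\<infinity>\<sigma>\<in>?X. (c \<sigma>)\<^sup>2 * ?h \<sigma>)"
    if "c \<in> l2t_chains G S t" for c \<tau>
    by (rule weighted_schur_test[where X = ?X and Y = ?X and h = ?h and k = ?h and A = A
          and p = "\<lambda>\<tau> \<sigma>. \<beta> ^ wdist (rep \<tau>) (rep \<sigma>)", OF pos(1) pos(1) pos(2) row col K1 CK l2[OF that]];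
        assumption)+
  have T_sum: "(\<lambda>\<tau>. (T c \<tau>)\<^sup>2 * ?h \<tau>) summable_on ?X"
    and T_norm: "(\<Sum>\<^sub>\<infinity>\<tau>\<in>?X. (T c \<tau>)\<^sup>2 * ?h \<tau>) \<le> K1 * (C * K) * (\<Sum>\<^sub>\<infinity>\<sigma>\<in>?X. (c \<sigma>)\<^sup>2 * ?h \<sigma>)"
    if "c \<in> l2t_chains G S t" for c
  proof -
    have eq: "(T c \<tau>)\<^sup>2 * ?h \<tau> = (\<Sum>\<^sub>\<infinity>\<sigma>\<in>?X. A \<tau> \<sigma> * c \<sigma>)\<^sup>2 * ?h \<tau>" if "\<tau> \<in> ?X" for \<tau>
      using that by (simp add: T_def)
    show "(\<lambda>\<tau>. (T c \<tau>)\<^sup>2 * ?h \<tau>) summable_on ?X"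
      using sum2[OF that] by (simp add: eq cong: summable_on_cong)
    show "(\<Sum>\<^sub>\<infinity>\<tau>\<in>?X. (T c \<tau>)\<^sup>2 * ?h \<tau>) \<le> K1 * (C * K) * (\<Sum>\<^sub>\<infinity>\<sigma>\<in>?X. (c \<sigma>)\<^sup>2 * ?h \<sigma>)"
      using norm2[OF that] by (simp add: eq cong: infsum_cong)
  qed
  show ?thesis
  \<comment> \<open>The Schur test bounds squared norms, hence the square root in the operator
    bound.\<close>
  proof (intro exI[of _ T] exI[of _ "sqrt (K1 * (C * K))"] conjI ballI allI)
    show "T c \<in> l2t_chains G S t" if "c \<in> l2t_chains G S t" for c
      using T_sum[OF that] by (auto simp: l2t_chains_def T_def)
    show "T (\<lambda>\<tau>. c1 \<tau> + c2 \<tau>) = (\<lambda>\<tau>. T c1 \<tau> + T c2 \<tau>)"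
      if "c1 \<in> l2t_chains G S t" "c2 \<in> l2t_chains G S t" for c1 c2
      using summ[OF that(1)] summ[OF that(2)] by (auto simp: T_def distrib_left infsum_add)
    show "T (\<lambda>\<tau>. a * c \<tau>) = (\<lambda>\<tau>. a * T c \<tau>)" for a c
    proof
      fix \<tau>
      have "(\<lambda>\<sigma>. A \<tau> \<sigma> * (a * c \<sigma>)) = (\<lambda>\<sigma>. a * (A \<tau> \<sigma> * c \<sigma>))" by (simp add: mult.left_commute)
      then show "T (\<lambda>\<tau>. a * c \<tau>) \<tau> = a * T c \<tau>" by (simp add: T_def infsum_cmult_right')
    qed
    show "l2t_norm G S t (T c) \<le> sqrt (K1 * (C * K)) * l2t_norm G S t c" if "c \<in> l2t_chains G S t" for c
      unfolding l2t_norm_def real_sqrt_mult[symmetric] using T_norm[OF that] by (rule real_sqrt_le_mono)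
    show "T c = H c" if c: "c \<in> fin_chains G S" for c
    proof
      fix \<tau>
      have fin: "finite {\<sigma>. c \<sigma> \<noteq> 0}" "{\<sigma>. c \<sigma> \<noteq> 0} \<subseteq> ?X" using c by (auto simp: fin_chains_def)
      have Hc: "H c \<tau> = (\<Sum>\<sigma> | c \<sigma> \<noteq> 0. A \<tau> \<sigma> * c \<sigma>)"
        using linear_on_fin_chains[OF H_add H_scale c] by (simp add: A_def mult.commute)
      show "T c \<tau> = H c \<tau>"
      proof (cases "\<tau> \<in> ?X")
        case True
        have "(\<Sum>\<^sub>\<infinity>\<sigma>\<in>?X. A \<tau> \<sigma> * c \<sigma>) = (\<Sum>\<^sub>\<infinity>\<sigma>\<in>{\<sigma>. c \<sigma> \<noteq> 0}. A \<tau> \<sigma> * c \<sigma>)"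
          using fin by (intro infsum_cong_neutral) auto
        then show ?thesis using True fin Hc by (simp add: T_def)
      next
        case False
        \<comment> \<open>By the degree condition H(\<sigma>) is a chain of simplices, so it
          vanishes at \<tau>, in agreement with the default value of \<open>T\<close>.\<close>
        have "A \<tau> \<sigma> = 0" if "\<sigma> \<in> ?X" for \<sigma>
          using H_deg simplex_chain_fin[OF that] False by (fastforce simp: A_def fin_kchains_def fin_chains_def)
        then have "H c \<tau> = 0" unfolding Hc using fin by (intro sum.neutral) auto
        then show ?thesis using False by (simp add: T_def)
      qed
    qed
  qed
qed

end
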